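(* Let $\alpha\ge1$ be an integer and let $P_0=\{(i,j,k)\in[1,2\alpha]^3:\ \text{at most one of } i,j,k \text{ exceeds } \alpha\}$. Consider the set of cyclically symmetric transpose--complementary plane partitions $P$ contained in the box $[1,2\alpha]^3$, and let $n(P)$ be the number of orbits of the cyclic map $\rho:(i,j,k)\mapsto(j,k,i)$ that are contained in $P$ but not contained in $P_0$. Then $$\sum_P(-1)^{n(P)}=\begin{cases}\left(\displaystyle\prod_{k=1}^{(\alpha-1)/2}\frac{(6k-2)!}{(2k+\alpha-1)!}\right)^2 & \text{if $\alpha$ is odd},\\ 0 & \text{if $\alpha$ is even.}\end{cases}$$
   Context: A plane partition is a finite set $P$ of points $(i,j,k)$ with positive integer coordinates such that if $(i,j,k)\in P$ and $1\le i'\le i$, $1\le j'\le j$, $1\le k'\le k$, then $(i',j',k')\in P$. $P$ is contained in the box $[1,2\alpha]^3$ if all coordinates of its points are at most $2\alpha$. $P$ is cyclically symmetric if $(i,j,k)\in P$ implies $(j,k,i)\in P$. $P$ (in the box $2\alpha\times2\alpha\times2\alpha$) is transpose--complementary if whenever $(i,j,k)\in P$ then $(2\alpha+1-j,2\alpha+1-i,2\alpha+1-k)\notin P$, for all $1\le i,j,k\le 2\alpha$. The set $P_0$ is itself a cyclically symmetric transpose--complementary plane partition (it has weight $1$). Empty products equal $1$.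
   Formalization: Transpose-complementary is read as an equivalence: exactly one of (i,j,k) and (2α+1-j,2α+1-i,2α+1-k) lies in P. With the one-way implication the claim fails: for α=1 the empty set, {(1,1,1)} and P_0 all qualify, giving 3 instead of 1. *)

theory Defs
  imports Complex_Main "HOL-Combinatorics.Orbits"
begin

type_synonym point = "nat \<times> nat \<times> nat"

definition plane_partition :: "point set \<Rightarrow> bool" where
  "plane_partition P \<longleftrightarrow>
     finite P \<and>
     (\<forall>i j k. (i, j, k) \<in> P \<longrightarrow> 1 \<le> i \<and> 1 \<le> j \<and> 1 \<le> k) \<and>
     (\<forall>i j k i' j' k'.
        (i, j, k) \<in> P \<and> 1 \<le> i' \<and> i' \<le> i \<and> 1 \<le> j' \<and> j' \<le> j \<and> 1 \<le> k' \<and> k' \<le> k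
          \<longrightarrow> (i', j', k') \<in> P)"

definition cube :: "nat \<Rightarrow> point set" where
  "cube N = {1..N} \<times> {1..N} \<times> {1..N}"

definition rho :: "point \<Rightarrow> point" where
  "rho = (\<lambda>(i, j, k). (j, k, i))"

definition cyclically_symmetric :: "point set \<Rightarrow> bool" where
  "cyclically_symmetric P \<longleftrightarrow> (\<forall>p \<in> P. rho p \<in> P)"

text \<open>Transpose-complementarity is relative to the side \<open>N\<close> of the box, and is read in the usual
  sense that \<open>P\<close> is the transpose of its complement: of a point of the box and its image, exactly
  one lies in \<open>P\<close>. Requiring only that they do not both lie in \<open>P\<close> would admit, for instance,
  the empty partition.\<close>

definition transpose_complementary :: "nat \<Rightarrow> point set \<Rightarrow> bool" where
  "transpose_complementary N P \<longleftrightarrow>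
     (\<forall>i \<in> {1..N}. \<forall>j \<in> {1..N}. \<forall>k \<in> {1..N}.
        (i, j, k) \<in> P \<longleftrightarrow> (N + 1 - j, N + 1 - i, N + 1 - k) \<notin> P)"

definition CSTCPP :: "nat \<Rightarrow> point set set" where
  "CSTCPP \<alpha> = {P. plane_partition P \<and> P \<subseteq> cube (2 * \<alpha>) \<and> cyclically_symmetric P
                  \<and> transpose_complementary (2 * \<alpha>) P}"

definition P0 :: "nat \<Rightarrow> point set" where
  "P0 \<alpha> = {(i, j, k) \<in> cube (2 * \<alpha>).
             \<not> (\<alpha> < i \<and> \<alpha> < j) \<and> \<not> (\<alpha> < i \<and> \<alpha> < k) \<and> \<not> (\<alpha> < j \<and> \<alpha> < k)}"

definition n_orbits :: "nat \<Rightarrow> point set \<Rightarrow> nat" where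
  "n_orbits \<alpha> P = card {Q \<in> range (orbit rho). Q \<subseteq> P \<and> \<not> Q \<subseteq> P0 \<alpha>}"

end

theory Submission
  imports Defs "Jordan_Normal_Form.Determinant"
begin

text \<open>Let \<open>n = \<alpha> - 1\<close>. A cyclically symmetric transpose-complementary plane partition \<open>P\<close> is
  determined by the points missing from it that have only the last coordinate above \<open>\<alpha>\<close>. These
  form a chain of \<open>n\<close> partitions, the \<open>s\<close>-th in an \<open>s \<times> s\<close> box, and \<open>n(P)\<close> is their total
  size. The boundaries of the partitions are nonintersecting lattice paths, so the signed sum is a
  determinant; its \<open>(s, r)\<close> entry is, up to a harmless sign, the coefficient of
  \<open>y ^ (2 * r - s)\<close> in the product of \<open>1 + (- 1) ^ l * y\<close> over \<open>1 \<le> l \<le> s\<close> and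
  \<open>y + (- 1) ^ l\<close> over \<open>0 \<le> l < r\<close>. It vanishes when \<open>s\<close> and \<open>r\<close> are both odd. For
  odd \<open>n\<close> this zero block is too large for a nonzero determinant; for \<open>n = 2 * m\<close> it leaves a product
  of two \<open>m \<times> m\<close> determinants, both equal up to sign to that of the
  Mills-Robbins-Rumsey matrix with entries \<open>(i + j + 1) choose (2 * j - i)\<close>. The latter is evaluated by
  an explicit triangular factorisation: the upper factor is hypergeometric, and the lower one satisfies
  a first-order recurrence along its columns.\<close>

section \<open>The Mills-Robbins-Rumsey determinant\<close>

text \<open>Column \<open>n\<close> of the upper triangular factor that makes the binomial matrix below lower
  triangular, up to scaling. The closed form was found experimentally.\<close>

definition kernel_coeff :: "nat \<Rightarrow> nat \<Rightarrow> rat" where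
  "kernel_coeff n j = (\<Prod>l<j. - 2 * (of_nat n - of_nat l) * (2 * of_nat n + 2 * of_nat l + 3)
     / ((2 * of_nat n + 3 + of_nat l) * (2 * of_nat n - of_nat l)))"

lemma kernel_coeff_Suc:
  assumes "j \<le> n"
  shows "(2 * of_nat n + 3 + of_nat j) * (2 * of_nat n - of_nat j) * kernel_coeff n (Suc j) =
    - 2 * (of_nat n - of_nat j) * (2 * of_nat n + 2 * of_nat j + 3) * kernel_coeff n j"
proof (cases "n = 0")
  case True
  then show ?thesis using assms by simp
next
  case False
  have "(2 * of_nat n - of_nat j :: rat) = of_nat (2 * n - j)" using assms by (simp add: of_nat_diff)
  then have "(2 * of_nat n - of_nat j :: rat) \<noteq> 0" using assms False by simp
  moreover have "(2 * of_nat n + 3 + of_nat j :: rat) = of_nat (2 * n + 3 + j)" by simp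
  then have "(2 * of_nat n + 3 + of_nat j :: rat) \<noteq> 0" by (simp only: of_nat_eq_0_iff)
  ultimately show ?thesis by (simp add: kernel_coeff_def)
qed

lemma kernel_coeff_nonzero:
  assumes "j \<le> n"
  shows "kernel_coeff n j \<noteq> 0"
proof -
  have "(of_nat n - of_nat l :: rat) \<noteq> 0" "(2 * of_nat n + 2 * of_nat l + 3 :: rat) \<noteq> 0"
    "(2 * of_nat n + 3 + of_nat l :: rat) \<noteq> 0" "(2 * of_nat n - of_nat l :: rat) \<noteq> 0" if "l < j" for l
  proof -
    have "(2 * of_nat n - of_nat l :: rat) = of_nat (2 * n - l)" using assms that by (simp add: of_nat_diff)
    then show "(2 * of_nat n - of_nat l :: rat) \<noteq> 0" using assms that by simp
    show "(of_nat n - of_nat l :: rat) \<noteq> 0" using assms that by simp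
    have "(2 * of_nat n + 2 * of_nat l + 3 :: rat) > 0" "(2 * of_nat n + 3 + of_nat l :: rat) > 0"
      by (simp_all add: add_nonneg_pos add_pos_nonneg)
    then show "(2 * of_nat n + 2 * of_nat l + 3 :: rat) \<noteq> 0" "(2 * of_nat n + 3 + of_nat l :: rat) \<noteq> 0"
      by simp_all
  qed
  then show ?thesis by (auto simp: kernel_coeff_def)
qed

text \<open>The lower index is an integer and values outside the range are 0, so that Pascal's rule
  and absorption hold without side conditions.\<close>

definition zbinom :: "nat \<Rightarrow> int \<Rightarrow> rat" where
  "zbinom m k = (if k < 0 then 0 else of_nat (m choose nat k))"

lemma zbinom_0: "zbinom 0 k = of_bool (k = 0)"
  by (auto simp: zbinom_def)

lemma zbinom_Suc: "zbinom (Suc m) k = zbinom m k + zbinom m (k - 1)"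
proof (cases "k \<le> 0")
  case True
  then show ?thesis by (auto simp: zbinom_def)
next
  case False
  then have "k = int (Suc (nat k - 1))" by simp
  then obtain l where "k = int (Suc l)" by blast
  then show ?thesis by (simp add: zbinom_def nat_add_distrib)
qed

lemma zbinom_absorb: "of_int k * zbinom m k = (of_nat m - of_int k + 1) * zbinom m (k - 1)"
proof (induction m arbitrary: k)
  case 0
  then show ?case by (auto simp: zbinom_0)
next
  case (Suc m)
  show ?case using Suc[of k] Suc[of "k - 1"]
    by (simp add: zbinom_Suc algebra_simps)
qed

lemma zbinom_eq_0: "k < 0 \<or> k > int m \<Longrightarrow> zbinom m k = 0"
  by (auto simp: zbinom_def)

lemma zbinom_sym: "zbinom m k = zbinom m (int m - k)"
proof (cases "0 \<le> k \<and> k \<le> int m")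
  case True
  then obtain l where "k = int l" "l \<le> m" by (metis of_nat_le_iff zero_le_imp_eq_int)
  then show ?thesis using binomial_symmetric[of l m] by (simp add: zbinom_def flip: of_nat_diff)
qed (auto simp: zbinom_eq_0)

text \<open>Entry \<open>(i, n)\<close> of the product of \<open>mrr_mat\<close> with the triangular
  matrix of the \<open>kernel_coeff\<close>.\<close>

definition mrr_sum :: "nat \<Rightarrow> nat \<Rightarrow> rat" where
  "mrr_sum n i = (\<Sum>j\<le>n. zbinom (i + j + 1) (2 * int j - int i) * kernel_coeff n j)"

text \<open>Zeilberger's method: the recurrence in \<open>i\<close> applied to the summand of \<open>mrr_sum\<close> below is a
  telescoping difference in \<open>j\<close>, once the last term is read as \<open>- G (Suc j)\<close> through
  \<open>kernel_coeff_Suc\<close>.\<close>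

lemma zeilberger_certificate:
  fixes n i j :: nat and c :: rat
  shows "(of_nat i + 2 * of_nat n + 3) * (2 * of_nat n - of_nat i) * (zbinom (i + j + 1) (2 * int j - int i) * c)
    - 2 * (of_nat i + 1 - of_nat n) * (2 * of_nat i + 2 * of_nat n + 5) * (zbinom (i + j + 2) (2 * int j - int i - 1) * c)
   = (2 * of_nat n + 2 + of_nat j) * (2 * of_nat n + 1 - of_nat j) * c * zbinom (i + j + 1) (2 * int j - int i - 2)
   + 2 * (of_nat n - of_nat j) * (2 * of_nat n + 2 * of_nat j + 3) * c * zbinom (i + j + 2) (2 * int j - int i)"
proof -
  define k where "k = 2 * int j - int i"
  define b0 b1 b2 where "b0 = zbinom (i + j + 1) (k - 2)" and "b1 = zbinom (i + j + 1) (k - 1)" and "b2 = zbinom (i + j + 1) k"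
  have e: "zbinom (i + j + 2) k = b2 + b1" "zbinom (i + j + 2) (k - 1) = b1 + b0"
    using zbinom_Suc[of "i + j + 1"] by (simp_all add: b0_def b1_def b2_def)
  have "of_int k * b2 = (of_nat (i + j + 1) - of_int k + 1) * b1"
    unfolding b1_def b2_def by (rule zbinom_absorb)
  then have 1: "(2 * of_nat j - of_nat i) * b2 = (2 * of_nat i - of_nat j + 2) * b1"
    by (simp add: k_def algebra_simps)
  have "of_int (k - 1) * b1 = (of_nat (i + j + 1) - of_int (k - 1) + 1) * b0"
    unfolding b1_def b0_def using zbinom_absorb[of "k - 1"] by simp
  then have 2: "(2 * of_nat j - of_nat i - 1) * b1 = (2 * of_nat i - of_nat j + 3) * b0"
    by (simp add: k_def algebra_simps)
  define x y z :: rat where "x = of_nat i" and "y = of_nat j" and "z = of_nat n"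
  have "(x + 2 * z + 3) * (2 * z - x) * b2 - 2 * (x + 1 - z) * (2 * x + 2 * z + 5) * (b1 + b0)
   = (2 * z + 2 + y) * (2 * z + 1 - y) * b0 + 2 * (z - y) * (2 * z + 2 * y + 3) * (b2 + b1)"
  proof -
    \<comment> \<open>The two sides differ by a combination of the absorption relations 1 and 2. The
      multipliers are found by dividing the coefficients of \<open>b2\<close> and \<open>b0\<close>,
      in which \<open>z\<close> cancels, by \<open>2 * y - x\<close> and
      \<open>2 * x - y + 3\<close>.\<close>
    have "(x + 2 * z + 3) * (2 * z - x) * b2 - 2 * (x + 1 - z) * (2 * x + 2 * z + 5) * (b1 + b0)
       - ((2 * z + 2 + y) * (2 * z + 1 - y) * b0 + 2 * (z - y) * (2 * z + 2 * y + 3) * (b2 + b1))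
     = (2 * y + x + 3) * ((2 * y - x) * b2 - (2 * x - y + 2) * b1) + (y + 2 * x + 4) * ((2 * y - x - 1) * b1 - (2 * x - y + 3) * b0)"
      by (simp add: algebra_simps)
    then show ?thesis
      using 1 2 unfolding x_def[symmetric] y_def[symmetric] z_def[symmetric] by simp
  qed
  from arg_cong[OF this, of "\<lambda>t. t * c"] show ?thesis
    unfolding k_def[symmetric] e x_def[symmetric] y_def[symmetric] z_def[symmetric] b0_def[symmetric] b2_def[symmetric]
    by (simp add: algebra_simps)
qed

lemma mrr_sum_rec:
  "(of_nat i + 2 * of_nat n + 3) * (2 * of_nat n - of_nat i) * mrr_sum n i =
   2 * (of_nat i + 1 - of_nat n) * (2 * of_nat i + 2 * of_nat n + 5) * mrr_sum n (Suc i)"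
proof -
  define G where "G j = (2 * of_nat n + 2 + of_nat j) * (2 * of_nat n + 1 - of_nat j) * kernel_coeff n j
     * zbinom (i + j + 1) (2 * int j - int i - 2)" for j
  have "(of_nat i + 2 * of_nat n + 3) * (2 * of_nat n - of_nat i) * (zbinom (i + j + 1) (2 * int j - int i) * kernel_coeff n j)
    - 2 * (of_nat i + 1 - of_nat n) * (2 * of_nat i + 2 * of_nat n + 5) * (zbinom (Suc i + j + 1) (2 * int j - int (Suc i)) * kernel_coeff n j)
    = G j - G (Suc j)" if "j \<le> n" for j
  proof -
    have "G (Suc j) = ((2 * of_nat n + 3 + of_nat j) * (2 * of_nat n - of_nat j) * kernel_coeff n (Suc j))
       * zbinom (i + j + 2) (2 * int j - int i)"
      by (simp add: G_def algebra_simps)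
    then show ?thesis
      unfolding kernel_coeff_Suc[OF that] using zeilberger_certificate[of i n j "kernel_coeff n j"]
      by (simp add: G_def algebra_simps)
  qed
  then have "(of_nat i + 2 * of_nat n + 3) * (2 * of_nat n - of_nat i) * mrr_sum n i -
     2 * (of_nat i + 1 - of_nat n) * (2 * of_nat i + 2 * of_nat n + 5) * mrr_sum n (Suc i) =
     (\<Sum>j\<le>n. G j - G (Suc j))"
    by (simp add: mrr_sum_def sum_distrib_left flip: sum_subtractf del: of_nat_Suc)
  \<comment> \<open>Both boundary terms vanish: \<open>G 0\<close> has a negative lower index, and
    \<open>G (Suc n)\<close> contains the numerator factor \<open>n - j\<close> of
    \<open>kernel_coeff\<close> at \<open>j = n\<close>.\<close>
  also have "\<dots> = G 0 - G (Suc n)"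
    by (induction n) (auto simp: algebra_simps)
  also have "G 0 = 0" by (simp add: G_def zbinom_def)
  also have "G (Suc n) = 0"
    using kernel_coeff_Suc[of n n] by (auto simp: G_def)
  finally show ?thesis by simp
qed

text \<open>The right-hand side coefficient of \<open>mrr_sum_rec\<close> vanishes at \<open>i + 1 = n\<close>.\<close>

lemma mrr_sum_eq_0: "i < n \<Longrightarrow> mrr_sum n i = 0"
proof (induction "n - i" arbitrary: i)
  case (Suc d)
  have "(of_nat i + 1 - of_nat n) * mrr_sum n (Suc i) = 0"
    using Suc by (cases "Suc i = n") auto
  moreover have nz: "(of_nat i + 2 * of_nat n + 3) * (2 * of_nat n - of_nat i) \<noteq> (0::rat)"
  proof -
    have "(of_nat i + 2 * of_nat n + 3) * (2 * of_nat n - of_nat i) = (of_nat ((i + 2 * n + 3) * (2 * n - i)) :: rat)"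
      using Suc(3) by (simp add: of_nat_diff)
    also have "\<dots> \<noteq> 0" using Suc(3) by (simp only: of_nat_eq_0_iff) simp
    finally show ?thesis .
  qed
  moreover have "(of_nat i + 2 * of_nat n + 3) * (2 * of_nat n - of_nat i) * mrr_sum n i =
      2 * (2 * of_nat i + 2 * of_nat n + 5) * ((of_nat i + 1 - of_nat n) * mrr_sum n (Suc i))"
    using mrr_sum_rec[of i n] by (simp only: mult_ac)
  ultimately have "(of_nat i + 2 * of_nat n + 3) * (2 * of_nat n - of_nat i) * mrr_sum n i = 0"
    by (simp only: mult_zero_right)
  with nz show ?case by (metis mult_eq_0_iff)
qed simp

text \<open>For \<open>i = 2 * n\<close> and \<open>j < n\<close> the lower index is negative, so
  one term survives. This anchors the recurrence, which is then followed down to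
  \<open>i = n\<close>.\<close>

lemma mrr_sum_top: "mrr_sum n (2 * n) = kernel_coeff n n"
proof -
  have "mrr_sum n (2 * n) = (\<Sum>j\<in>{n}. zbinom (2 * n + j + 1) (2 * int j - int (2 * n)) * kernel_coeff n j)"
    unfolding mrr_sum_def by (intro sum.mono_neutral_right) (auto simp: zbinom_def)
  then show ?thesis by (simp add: zbinom_def)
qed

text \<open>The factorials solve the first-order recurrence at \<open>i = n + l\<close>: with them
  the product no longer depends on \<open>l\<close>. The odd factors
  \<open>4 * n + 2 * l + 5\<close> come from a factorial whose argument advances by two; its even
  factors are twice those of \<open>fact (2 * n + l + 2)\<close>.\<close>

lemma mrr_sum_invariant:
  assumes "l \<le> n"
  shows "mrr_sum n (n + l) * (fact l * fact (n - l) * fact (4 * n + 2 * l + 4)) / (fact (3 * n + l + 2) * fact (2 * n + l + 2))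
    = kernel_coeff n n * (fact n * fact (6 * n + 4)) / (fact (4 * n + 2) * fact (3 * n + 2))"
  using assms
proof (induction rule: inc_induct)
  case base
  then show ?case using mrr_sum_top[of n] by (simp add: mult_2[symmetric] algebra_simps)
next
  case (step l)
  have nl: "fact (n - l) = (of_nat n - of_nat l) * (fact (n - Suc l) :: rat)"
    using step(2) by (simp add: fact_reduce of_nat_diff)
  have f1: "fact (4 * n + 2 * Suc l + 4) = (of_nat (4 * n + 2 * l + 6)) * (of_nat (4 * n + 2 * l + 5)) * (fact (4 * n + 2 * l + 4) :: rat)"
  proof -
    have "4 * n + 2 * Suc l + 4 = Suc (Suc (4 * n + 2 * l + 4))" by simp
    then show ?thesis by (simp only: fact_Suc) (simp add: algebra_simps del: fact_Suc)
  qed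
  have f2: "fact (3 * n + Suc l + 2) = of_nat (3 * n + l + 3) * (fact (3 * n + l + 2) :: rat)"
    by (simp add: numeral_eq_Suc algebra_simps)
  have f3: "fact (2 * n + Suc l + 2) = of_nat (2 * n + l + 3) * (fact (2 * n + l + 2) :: rat)"
    by (simp add: numeral_eq_Suc algebra_simps)
  have f4: "fact (Suc l) = of_nat (l + 1) * (fact l :: rat)" by simp
  have f5: "of_nat (3 * n + l + 3) * (of_nat n - of_nat l) * mrr_sum n (n + l)
    = of_nat (2 * (l + 1)) * of_nat (4 * n + 2 * l + 5) * mrr_sum n (n + Suc l)"
    using mrr_sum_rec[of "n + l" n] by (simp add: algebra_simps)
  \<comment> \<open>The cancellation in abstract variables, so that no factorial gets
    unfolded.\<close>
  have gen: "x * (L * (d * F) * H) / (A * B) = x' * (v * L * F * (p * q * H)) / ((a * A) * (b * B))"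
    if "a * d * x = 2 * v * q * x'" "p = 2 * b" "a \<noteq> 0" "b \<noteq> 0" for x x' L d F H A B v p q a b :: rat
  proof -
    have "x' * (v * L * F * (p * q * H)) / ((a * A) * (b * B)) = (2 * v * q * x') * b * (L * F * H) / ((a * A) * (b * B))"
      by (simp add: that(2) algebra_simps)
    also have "\<dots> = (a * d * x) * b * (L * F * H) / ((a * A) * (b * B))"
      unfolding that(1) ..
    also have "\<dots> = x * (L * (d * F) * H) / (A * B)"
      using that(3,4) by simp
    finally show ?thesis by simp
  qed
  have "mrr_sum n (n + l) * (fact l * fact (n - l) * fact (4 * n + 2 * l + 4)) / (fact (3 * n + l + 2) * fact (2 * n + l + 2))
     = mrr_sum n (n + Suc l) * (fact (Suc l) * fact (n - Suc l) * fact (4 * n + 2 * Suc l + 4)) / (fact (3 * n + Suc l + 2) * fact (2 * n + Suc l + 2))"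
    unfolding nl f1 f2 f3 f4 proof (rule gen)
    show "of_nat (3 * n + l + 3) * (of_nat n - of_nat l) * mrr_sum n (n + l)
      = 2 * of_nat (l + 1) * of_nat (4 * n + 2 * l + 5) * mrr_sum n (n + Suc l)"
      using f5 by (simp only: of_nat_mult of_nat_numeral)
    show "rat_of_nat (4 * n + 2 * l + 6) = 2 * of_nat (2 * n + l + 3)" by simp
    show "rat_of_nat (3 * n + l + 3) \<noteq> 0" "rat_of_nat (2 * n + l + 3) \<noteq> 0"
      unfolding of_nat_eq_0_iff by simp_all
  qed
  then show ?case using step.IH by simp
qed

lemma mrr_pivot:
  "mrr_sum n n = kernel_coeff n n * (fact (6 * n + 4) * fact (2 * n + 2) / (fact (4 * n + 4) * fact (4 * n + 2)))"
  using mrr_sum_invariant[of 0 n] by (simp add: field_simps del: fact_Suc)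

definition mrr_mat :: "nat \<Rightarrow> rat mat" where
  "mrr_mat m = mat m m (\<lambda>(i, j). zbinom (i + j + 1) (2 * int j - int i))"

text \<open>Multiplication by the upper triangular \<open>U\<close> gives a lower triangular matrix
  with diagonal \<open>mrr_sum n n\<close>; the factor \<open>kernel_coeff n n\<close> in each pivot
  is the diagonal entry of \<open>U\<close> and cancels.\<close>

lemma det_mrr_mat_pivots:
  "det (mrr_mat m) = (\<Prod>n<m. fact (6 * n + 4) * fact (2 * n + 2) / (fact (4 * n + 4) * fact (4 * n + 2)))"
proof -
  define U where "U = mat m m (\<lambda>(j, n). if j \<le> n then kernel_coeff n j else 0)"
  have carr: "mrr_mat m \<in> carrier_mat m m" "U \<in> carrier_mat m m" by (auto simp: mrr_mat_def U_def)
  have MU: "(mrr_mat m * U) $$ (i, n) = mrr_sum n i" if "i < m" "n < m" for i n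
  proof -
    have "(mrr_mat m * U) $$ (i, n) = (\<Sum>j<m. zbinom (i + j + 1) (2 * int j - int i) * (if j \<le> n then kernel_coeff n j else 0))"
      using that by (simp add: mrr_mat_def U_def scalar_prod_def atLeast0LessThan)
    also have "\<dots> = mrr_sum n i"
      unfolding mrr_sum_def using that by (intro sum.mono_neutral_cong_right) auto
    finally show ?thesis .
  qed
  have "det (mrr_mat m * U) = prod_list (diag_mat (mrr_mat m * U))"
    using carr by (intro det_lower_triangular[of m]) (auto simp: MU mrr_sum_eq_0 simp del: index_mult_mat)
  also have "\<dots> = (\<Prod>n<m. mrr_sum n n)"
    using carr by (auto simp: prod_list_diag_prod MU atLeast0LessThan simp del: index_mult_mat(1) intro!: prod.cong)
  finally have 1: "det (mrr_mat m * U) = (\<Prod>n<m. mrr_sum n n)" .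
  have "det U = prod_list (diag_mat U)"
    by (intro det_upper_triangular[of _ m] upper_triangularI) (auto simp: U_def)
  also have "\<dots> = (\<Prod>n<m. kernel_coeff n n)"
    by (simp add: prod_list_diag_prod U_def atLeast0LessThan)
  finally have 2: "det U = (\<Prod>n<m. kernel_coeff n n)" .
  have "(\<Prod>n<m. kernel_coeff n n) \<noteq> 0" by (simp add: kernel_coeff_nonzero)
  moreover have "det (mrr_mat m) * (\<Prod>n<m. kernel_coeff n n) = (\<Prod>n<m. kernel_coeff n n) *
      (\<Prod>n<m. fact (6 * n + 4) * fact (2 * n + 2) / (fact (4 * n + 4) * fact (4 * n + 2)))"
    using 1 2 det_mult[OF carr] by (simp only: mrr_pivot prod.distrib)
  then have "(\<Prod>n<m. kernel_coeff n n) * det (mrr_mat m) = (\<Prod>n<m. kernel_coeff n n) *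
      (\<Prod>n<m. fact (6 * n + 4) * fact (2 * n + 2) / (fact (4 * n + 4) * fact (4 * n + 2)))"
    by (simp only: mult.commute)
  ultimately show ?thesis using mult_left_cancel by blast
qed

theorem det_mrr_mat: "det (mrr_mat m) = (\<Prod>k = 1..m. fact (6 * k - 2) / fact (2 * k + 2 * m))"
proof (induction m)
  case 0
  then show ?case by (simp add: mrr_mat_def)
next
  case (Suc m)
  \<comment> \<open>In the closed form, passing from \<open>m\<close> to \<open>Suc m\<close> moves
    every denominator up by two; the ratios of old to new denominators telescope.\<close>
  have tel: "(\<Prod>k = 1..m. fact (2 * k + 2 * m) / fact (2 * k + 2 * Suc m)) = (fact (2 * m + 2) / fact (4 * m + 2) :: rat)"
  proof -
    have "(\<Prod>k = 1..l. fact (2 * k + 2 * m) / fact (2 * k + 2 * Suc m)) = (fact (2 * m + 2) / fact (2 * m + 2 * l + 2) :: rat)" for l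
    proof (induction l)
      case (Suc l)
      then show ?case by (simp add: algebra_simps del: fact_Suc)
    qed (simp del: fact_Suc)
    from this[of m] show ?thesis by (simp add: algebra_simps del: fact_Suc)
  qed
  have split: "(\<Prod>k = 1..m. fact (6 * k - 2) / fact (2 * k + 2 * Suc m)) =
    (\<Prod>k = 1..m. fact (6 * k - 2) / fact (2 * k + 2 * m)) * (\<Prod>k = 1..m. fact (2 * k + 2 * m) / fact (2 * k + 2 * Suc m) :: rat)"
    unfolding prod.distrib[symmetric] by (intro prod.cong) auto
  have "(\<Prod>k = 1..Suc m. fact (6 * k - 2) / fact (2 * k + 2 * Suc m)) =
    det (mrr_mat m) * (fact (2 * m + 2) / fact (4 * m + 2)) * (fact (6 * m + 4) / fact (4 * m + 4))"
  proof -
    have e: "6 * Suc m - 2 = 6 * m + 4" "2 * Suc m + 2 * Suc m = 4 * m + 4" by simp_all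
    have "(\<Prod>k = 1..Suc m. fact (6 * k - 2) / fact (2 * k + 2 * Suc m)) =
      (\<Prod>k = 1..m. fact (6 * k - 2) / fact (2 * k + 2 * Suc m)) * (fact (6 * Suc m - 2) / fact (2 * Suc m + 2 * Suc m) :: rat)"
      by (simp only: prod.cl_ivl_Suc) simp
    then show ?thesis
      using split unfolding tel Suc e by (simp only:)
  qed
  moreover have "det (mrr_mat (Suc m)) = det (mrr_mat m) *
      (fact (6 * m + 4) * fact (2 * m + 2) / (fact (4 * m + 4) * fact (4 * m + 2)))"
    unfolding det_mrr_mat_pivots by (rule prod.lessThan_Suc)
  ultimately show ?case
    by (simp only: times_divide_eq_right times_divide_eq_left divide_divide_eq_left mult_ac)
qed

section \<open>Nonintersecting paths\<close>

lemma det_mat_Leibniz: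
  "det (mat n n (\<lambda>(i, j). f i j)) = (\<Sum>p | p permutes {0..<n}. signof p * (\<Prod>i = 0..<n. f i (p i)))"
  by (subst det_def'[of _ n])
    (auto intro!: sum.cong arg_cong2[where f = "(*)"] prod.cong dest: permutes_in_image)

lemma det_mat_cong:
  "(\<And>i j. i < n \<Longrightarrow> j < n \<Longrightarrow> f i j = g i j) \<Longrightarrow> det (mat n n (\<lambda>(i, j). f i j)) = det (mat n n (\<lambda>(i, j). g i j))"
  by (intro arg_cong[where f = det] cong_mat) auto

lemma det_scale_rows:
  "det (mat n n (\<lambda>(i, j). c i * f i j)) = (\<Prod>i<n. c i) * det (mat n n (\<lambda>(i, j). f i j :: 'a :: comm_ring_1))"
  by (simp add: det_mat_Leibniz prod.distrib sum_distrib_left mult_ac atLeast0LessThan)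

lemma det_zero_row:
  assumes "k < n" "\<And>j. j < n \<Longrightarrow> f k j = (0 :: 'a :: comm_ring_1)"
  shows "det (mat n n (\<lambda>(i, j). f i j)) = 0"
  unfolding det_mat_Leibniz
proof (intro sum.neutral ballI)
  fix p assume "p \<in> {p. p permutes {0..<n}}"
  then have "p k < n" using assms(1) by (auto dest: permutes_in_image)
  then have "(\<Prod>i = 0..<n. f i (p i)) = 0" using assms by (intro prod_zero) (auto intro!: bexI[of _ k])
  then show "signof p * (\<Prod>i = 0..<n. f i (p i)) = 0" by simp
qed

lemma det_equal_rows:
  assumes "k < n" "l < n" "k \<noteq> l" "\<And>j. j < n \<Longrightarrow> f k j = f l j"
  shows "det (mat n n (\<lambda>(i, j). f i j :: 'a :: comm_ring_1)) = 0"
  by (rule det_identical_rows[of _ n k l]) (use assms in \<open>auto intro!: eq_vecI\<close>)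

text \<open>Multilinearity in all rows at once. In the application \<open>E\<close> is the set of
  paths that move.\<close>

lemma det_add_rows:
  "det (mat n n (\<lambda>(i, j). f i j + g i j)) =
   (\<Sum>E\<in>Pow {..<n}. det (mat n n (\<lambda>(i, j). if i \<in> E then f i j else g i j :: 'a :: comm_ring_1)))"
proof -
  have eq: "(\<Prod>i = 0..<n. f i (p i) + g i (p i)) =
      (\<Sum>E\<in>Pow {..<n}. \<Prod>i = 0..<n. if i \<in> E then f i (p i) else g i (p i))" for p
    by (subst prod_add) (auto simp: prod.If_cases atLeast0LessThan Int_absorb1 Diff_eq intro!: sum.cong)
  show ?thesis
    unfolding det_mat_Leibniz eq by (subst sum.swap) (simp add: sum_distrib_left)
qed

text \<open>A state \<open>y\<close> records how far the \<open>n\<close> paths have moved up, path \<open>i\<close> being at height \<open>i + 1 + y i\<close>.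
  There are \<open>2 * n\<close> steps, up (or level) in the first half and down (or level) in the second, and
  \<open>m\<close> is the number of steps that remain after the present one. The lower bounds on the height
  keep every path at its end points \<open>i + 1\<close> at the times when the diagonal of an
  \<open>(i + 1) \<times> (i + 1)\<close> box is empty.\<close>

definition path_step :: "nat \<Rightarrow> nat \<Rightarrow> (nat \<Rightarrow> nat) \<Rightarrow> (nat \<Rightarrow> nat) \<Rightarrow> bool" where
  "path_step n m y y' \<longleftrightarrow>
     (\<forall>i<n. y' i = y i \<or>
        (if n \<le> m then y' i = Suc (y i) \<and> Suc m - n \<le> Suc (i + y i)
         else y i = Suc (y' i) \<and> Suc n - m \<le> Suc (i + y i))) \<and>
     (\<forall>i\<ge>n. y' i = 0) \<and> (\<forall>i. Suc i < n \<longrightarrow> y' i \<le> y' (Suc i))"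

text \<open>The sign of a height instead of a displacement is harmless: over all \<open>2 * n\<close> steps each
  starting height is counted an even number of times.\<close>

fun family_sum :: "nat \<Rightarrow> nat \<Rightarrow> (nat \<Rightarrow> nat) \<Rightarrow> rat" where
  "family_sum n 0 y = of_bool (\<forall>i<n. y i = 0)"
| "family_sum n (Suc m) y =
     (\<Sum>y' | path_step n m y y'. (\<Prod>i<n. (- 1) ^ Suc (i + y' i)) * family_sum n m y')"

text \<open>Signed count of single paths from height \<open>p\<close> to height \<open>r\<close>
  with \<open>m\<close> steps left, under the bounds of \<open>path_step\<close>. A descent needs
  \<open>p\<close> at least 2, because \<open>Suc n - m\<close> is at least 2 when
  \<open>m < n\<close>; so \<open>p - 1\<close> is never truncated.\<close>

fun path_sum :: "nat \<Rightarrow> nat \<Rightarrow> nat \<Rightarrow> nat \<Rightarrow> rat" where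
  "path_sum n 0 p r = of_bool (p = r)"
| "path_sum n (Suc m) p r = (- 1) ^ p * path_sum n m p r +
     (if n \<le> m then (if Suc m - n \<le> p then (- 1) ^ Suc p * path_sum n m (Suc p) r else 0)
      else (if Suc n - m \<le> p then (- 1) ^ (p - 1) * path_sum n m (p - 1) r else 0))"

lemma family_sum_0:
  assumes mono: "\<And>i. Suc i < n \<Longrightarrow> y i \<le> y (Suc i)"
  shows "family_sum n 0 y = det (mat n n (\<lambda>(i, j). path_sum n 0 (Suc (i + y i)) (Suc j)))"
proof (cases "\<forall>i<n. y i = 0")
  case True
  then have "mat n n (\<lambda>(i, j). path_sum n 0 (Suc (i + y i)) (Suc j)) = 1\<^sub>m n"
    by (intro eq_matI) auto
  then show ?thesis using True by simp
next
  case False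
  then obtain i where i: "i < n" "y i \<noteq> 0" by blast
  have "i \<le> k \<Longrightarrow> k < n \<Longrightarrow> y i \<le> y k" for k
    by (induction k rule: dec_induct) (auto intro: order.trans[OF _ mono])
  from this[of "n - 1"] have "y i \<le> y (n - 1)" using i by simp
  then have "y (n - 1) \<noteq> 0" using i by simp
  \<comment> \<open>The top path is above every end point \<open>Suc j\<close>, so its row
    vanishes.\<close>
  then have "det (mat n n (\<lambda>(i, j). path_sum n 0 (Suc (i + y i)) (Suc j))) = 0"
    using i by (intro det_zero_row[of "n - 1"]) auto
  then show ?thesis using False by simp
qed

text \<open>Expanding the determinant by rows yields a choice of moves for the paths. A move that is not
  allowed gives a zero row, and moves that make two paths meet give two equal rows. No sign-reversing
  involution is needed.\<close>

lemma family_sum_up: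
  assumes mono: "\<And>i. Suc i < n \<Longrightarrow> y i \<le> y (Suc i)" and "n \<le> m"
    and IH: "\<And>y'. (\<And>i. Suc i < n \<Longrightarrow> y' i \<le> y' (Suc i)) \<Longrightarrow>
      family_sum n m y' = det (mat n n (\<lambda>(i, j). path_sum n m (Suc (i + y' i)) (Suc j)))"
  shows "family_sum n (Suc m) y = det (mat n n (\<lambda>(i, j). path_sum n (Suc m) (Suc (i + y i)) (Suc j)))"
proof -
  define f where "f i j = (if Suc m - n \<le> Suc (i + y i) then (- 1) ^ Suc (Suc (i + y i)) * path_sum n m (Suc (Suc (i + y i))) (Suc j) else 0)" for i j
  define g where "g i j = (- 1) ^ Suc (i + y i) * path_sum n m (Suc (i + y i)) (Suc j)" for i j
  define S where "S E i = (if i < n then y i + of_bool (i \<in> E) else 0)" for E i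
  define D where "D E = det (mat n n (\<lambda>(i, j). if i \<in> E then f i j else g i j))" for E
  have "det (mat n n (\<lambda>(i, j). path_sum n (Suc m) (Suc (i + y i)) (Suc j))) = (\<Sum>E\<in>Pow {..<n}. D E)"
    unfolding D_def det_add_rows[symmetric]
    using \<open>n \<le> m\<close> by (intro det_mat_cong) (simp add: f_def g_def)
  also have "\<dots> = (\<Sum>E\<in>{E \<in> Pow {..<n}. path_step n m y (S E)}. D E)"
  proof (rule sum.mono_neutral_right)
    show "\<forall>E\<in>Pow {..<n} - {E \<in> Pow {..<n}. path_step n m y (S E)}. D E = 0"
    proof
      fix E assume E: "E \<in> Pow {..<n} - {E \<in> Pow {..<n}. path_step n m y (S E)}"
      then consider i where "i < n" "i \<in> E" "\<not> Suc m - n \<le> Suc (i + y i)"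
        | "\<forall>i\<in>E. Suc m - n \<le> Suc (i + y i)" "\<not> path_step n m y (S E)" by auto
      then show "D E = 0"
      proof cases
        case 1
        then show ?thesis unfolding D_def by (intro det_zero_row[of i]) (auto simp: f_def)
      next
        case 2
        then obtain i where i: "Suc i < n" "\<not> S E i \<le> S E (Suc i)"
          using \<open>n \<le> m\<close> by (auto simp: path_step_def S_def)
        with mono[of i] have i': "i \<in> E" "Suc i \<notin> E" "y i = y (Suc i)"
          by (cases "i \<in> E"; cases "Suc i \<in> E"; simp add: S_def)+
        \<comment> \<open>Path \<open>i\<close> moves onto the height at which path
          \<open>Suc i\<close> stays, so their rows agree.\<close>
        show ?thesis unfolding D_def
          by (rule det_equal_rows[of i n "Suc i"]) (use 2 i i' in \<open>auto simp: f_def g_def\<close>)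
      qed
    qed
  qed auto
  also have "\<dots> = (\<Sum>y' | path_step n m y y'. (\<Prod>i<n. (- 1) ^ Suc (i + y' i)) * family_sum n m y')"
  proof (rule sum.reindex_bij_witness[of _ "\<lambda>y'. {i. i < n \<and> y' i \<noteq> y i}" S])
    show "S {i. i < n \<and> y' i \<noteq> y i} = y'" if "y' \<in> {y'. path_step n m y y'}" for y'
      using that \<open>n \<le> m\<close> by (auto simp: path_step_def S_def fun_eq_iff)
    then show "{i. i < n \<and> y' i \<noteq> y i} \<in> {E \<in> Pow {..<n}. path_step n m y (S E)}"
      if "y' \<in> {y'. path_step n m y y'}" for y'
      using that by auto
    show "(\<Prod>i<n. (- 1) ^ Suc (i + S E i)) * family_sum n m (S E) = D E"
      if "E \<in> {E \<in> Pow {..<n}. path_step n m y (S E)}" for E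
    proof -
      have ok: "Suc m - n \<le> Suc (i + y i)" if "i \<in> E" for i
        using that \<open>E \<in> _\<close> \<open>n \<le> m\<close> by (auto simp: path_step_def S_def split: if_splits)
      have fs: "family_sum n m (S E) = det (mat n n (\<lambda>(i, j). path_sum n m (Suc (i + S E i)) (Suc j)))"
        using that by (intro IH) (auto simp: path_step_def)
      show ?thesis
        unfolding fs D_def det_scale_rows[symmetric]
        using ok by (auto intro!: det_mat_cong simp: f_def g_def S_def)
    qed
  qed (auto simp: S_def)
  finally show ?thesis by simp
qed

text \<open>As in the first half, except that \<open>S\<close> subtracts truncatedly and represents
  the moves in \<open>E\<close> only where \<open>y\<close> is positive. Choices that lower a path
  with displacement 0 must therefore be shown separately to contribute 0.\<close>

lemma family_sum_down:
  assumes mono: "\<And>i. Suc i < n \<Longrightarrow> y i \<le> y (Suc i)" and "m < n"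
    and IH: "\<And>y'. (\<And>i. Suc i < n \<Longrightarrow> y' i \<le> y' (Suc i)) \<Longrightarrow>
      family_sum n m y' = det (mat n n (\<lambda>(i, j). path_sum n m (Suc (i + y' i)) (Suc j)))"
  shows "family_sum n (Suc m) y = det (mat n n (\<lambda>(i, j). path_sum n (Suc m) (Suc (i + y i)) (Suc j)))"
proof -
  define f where "f i j = (if Suc n - m \<le> Suc (i + y i) then (- 1) ^ (i + y i) * path_sum n m (i + y i) (Suc j) else 0)" for i j
  define g where "g i j = (- 1) ^ Suc (i + y i) * path_sum n m (Suc (i + y i)) (Suc j)" for i j
  define S where "S E i = (if i < n then y i - of_bool (i \<in> E) else 0)" for E i
  define D where "D E = det (mat n n (\<lambda>(i, j). if i \<in> E then f i j else g i j))" for E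
  have "det (mat n n (\<lambda>(i, j). path_sum n (Suc m) (Suc (i + y i)) (Suc j))) = (\<Sum>E\<in>Pow {..<n}. D E)"
    unfolding D_def det_add_rows[symmetric]
    using \<open>m < n\<close> by (intro det_mat_cong) (simp add: f_def g_def)
  also have "\<dots> = (\<Sum>E\<in>{E \<in> Pow {..<n}. (\<forall>i\<in>E. 0 < y i) \<and> path_step n m y (S E)}. D E)"
  proof (rule sum.mono_neutral_right)
    show "\<forall>E\<in>Pow {..<n} - {E \<in> Pow {..<n}. (\<forall>i\<in>E. 0 < y i) \<and> path_step n m y (S E)}. D E = 0"
    proof
      fix E assume E: "E \<in> Pow {..<n} - {E \<in> Pow {..<n}. (\<forall>i\<in>E. 0 < y i) \<and> path_step n m y (S E)}"
      then consider i where "i < n" "i \<in> E" "\<not> Suc n - m \<le> Suc (i + y i)"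
        | i where "\<forall>i\<in>E. Suc n - m \<le> Suc (i + y i)" "i \<in> E" "i < n" "y i = 0"
        | "\<forall>i\<in>E. Suc n - m \<le> Suc (i + y i)" "\<forall>i\<in>E. 0 < y i" "\<not> path_step n m y (S E)"
        by auto
      then show "D E = 0"
      proof cases
        case 1
        then show ?thesis unfolding D_def by (intro det_zero_row[of i]) (auto simp: f_def)
      next
        case 2
        \<comment> \<open>A path would leave through the bottom; then either a lower path blocks it, or path 0 itself
          has made a forbidden move.\<close>
        have y0: "k \<le> i \<Longrightarrow> y k = 0" for k
        proof (induction k rule: inc_induct)
          case (step k)
          then show ?case using mono[of k] 2(3) by simp
        qed (rule 2(4))
        have "0 \<notin> E"
          using 2(1) y0[of 0] \<open>m < n\<close> by auto
        have "\<exists>k<i. k \<notin> E \<and> Suc k \<in> E"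
        proof (rule ccontr)
          assume "\<not> ?thesis"
          then have "k \<le> i \<Longrightarrow> k \<notin> E" for k
            by (induction k) (use \<open>0 \<notin> E\<close> in \<open>auto simp: Suc_le_eq\<close>)
          then show False using 2(2) by blast
        qed
        then obtain k where k: "k < i" "k \<notin> E" "Suc k \<in> E" by blast
        show ?thesis unfolding D_def
          by (rule det_equal_rows[of k n "Suc k"]) (use 2 k y0[of k] y0[of "Suc k"] in \<open>auto simp: f_def g_def\<close>)
      next
        case 3
        have "S E i = y i \<or> y i = Suc (S E i) \<and> Suc n - m \<le> Suc (i + y i)" if "i < n" for i
          using 3(1,2) that by (cases "i \<in> E") (auto simp: S_def)
        moreover have "\<forall>i\<ge>n. S E i = 0" by (simp add: S_def)
        ultimately obtain i where i: "Suc i < n" "\<not> S E i \<le> S E (Suc i)"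
          using \<open>m < n\<close> 3(3) unfolding path_step_def by auto
        with mono[of i] 3(2) have i': "i \<notin> E" "Suc i \<in> E" "y i = y (Suc i)"
          by (cases "i \<in> E"; cases "Suc i \<in> E"; force simp: S_def)+
        show ?thesis unfolding D_def
          by (rule det_equal_rows[of i n "Suc i"]) (use 3 i i' in \<open>auto simp: f_def g_def\<close>)
      qed
    qed
  qed auto
  also have "\<dots> = (\<Sum>y' | path_step n m y y'. (\<Prod>i<n. (- 1) ^ Suc (i + y' i)) * family_sum n m y')"
  proof (rule sum.reindex_bij_witness[of _ "\<lambda>y'. {i. i < n \<and> y' i \<noteq> y i}" S])
    show 1: "S {i. i < n \<and> y' i \<noteq> y i} = y'" if "y' \<in> {y'. path_step n m y y'}" for y'
      using that \<open>m < n\<close> by (fastforce simp: path_step_def S_def fun_eq_iff)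
    show "{i. i < n \<and> y' i \<noteq> y i} \<in> {E \<in> Pow {..<n}. (\<forall>i\<in>E. 0 < y i) \<and> path_step n m y (S E)}"
      if "y' \<in> {y'. path_step n m y y'}" for y'
      using that 1[OF that] \<open>m < n\<close> by (auto simp: path_step_def)
    show "(\<Prod>i<n. (- 1) ^ Suc (i + S E i)) * family_sum n m (S E) = D E"
      if "E \<in> {E \<in> Pow {..<n}. (\<forall>i\<in>E. 0 < y i) \<and> path_step n m y (S E)}" for E
    proof -
      have pos: "0 < y i" if "i \<in> E" for i using that \<open>E \<in> _\<close> by auto
      have ok: "Suc n - m \<le> Suc (i + y i)" if "i \<in> E" for i
      proof -
        have "i < n" "path_step n m y (S E)" "S E i \<noteq> y i"
          using that \<open>E \<in> _\<close> pos[OF that] by (auto simp: S_def)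
        then show ?thesis using \<open>m < n\<close> by (auto simp: path_step_def)
      qed
      have fs: "family_sum n m (S E) = det (mat n n (\<lambda>(i, j). path_sum n m (Suc (i + S E i)) (Suc j)))"
        using that by (intro IH) (auto simp: path_step_def)
      show ?thesis
        unfolding fs D_def det_scale_rows[symmetric]
      proof (rule det_mat_cong)
        fix i j assume "i < n" "j < n"
        show "(- 1) ^ Suc (i + S E i) * path_sum n m (Suc (i + S E i)) (Suc j) = (if i \<in> E then f i j else g i j)"
        proof (cases "i \<in> E")
          case True
          then obtain z where "y i = Suc z" using pos by (metis gr0_conv_Suc)
          then show ?thesis using ok[OF True] True \<open>i < n\<close> by (simp add: f_def S_def)
        qed (use \<open>i < n\<close> in \<open>simp add: g_def S_def\<close>)
      qed
    qed
  qed (auto simp: S_def split: if_splits)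
  finally show ?thesis by simp
qed

text \<open>A Lindstrom-Gessel-Viennot formula, by induction on the number of steps left.\<close>

theorem family_sum_det:
  "(\<And>i. Suc i < n \<Longrightarrow> y i \<le> y (Suc i)) \<Longrightarrow>
   family_sum n m y = det (mat n n (\<lambda>(i, j). path_sum n m (Suc (i + y i)) (Suc j)))"
proof (induction m arbitrary: y)
  case 0
  then show ?case by (rule family_sum_0)
next
  case (Suc m)
  then show ?case by (cases "n \<le> m") (simp_all only: family_sum_up family_sum_down not_le)
qed

section \<open>Evaluation of the path determinant\<close>

definition zcoeff :: "rat poly \<Rightarrow> int \<Rightarrow> rat" where
  "zcoeff P k = (if k < 0 then 0 else coeff P (nat k))"

lemma zcoeff_mult_linear: "zcoeff ([:c, d:] * P) k = c * zcoeff P k + d * zcoeff P (k - 1)"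
proof (cases "k \<le> 0")
  case True
  then show ?thesis by (cases "k = 0") (auto simp: zcoeff_def)
next
  case False
  then have "k = int (Suc (nat k - 1))" by simp
  then obtain l where "k = int (Suc l)" by blast
  then show ?thesis by (simp add: zcoeff_def nat_add_distrib)
qed

lemma zcoeff_smult: "zcoeff (smult c P) k = c * zcoeff P k"
  by (simp add: zcoeff_def)

text \<open>Reading off the coefficient of \<open>y ^ (2 * r - p)\<close> instead of \<open>y ^ (p - r)\<close>, that is, letting \<open>y\<close>
  mark the level steps of the second half, makes the two halves of a path multiply as polynomials.\<close>

definition down_poly :: "nat \<Rightarrow> nat \<Rightarrow> rat poly" where
  "down_poly e r = monom 1 (min e r) * (\<Prod>l = e..<r. [:(- 1) ^ l, 1:])"

text \<open>Lowering \<open>e\<close> turns one factor \<open>y\<close> into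
  \<open>y + (- 1) ^ e\<close>: one more step at which the path may stay level or descend.\<close>

lemma zcoeff_down_poly_rec:
  assumes "e < r"
  shows "zcoeff (down_poly e r) k = zcoeff (down_poly (Suc e) r) k + (- 1) ^ e * zcoeff (down_poly (Suc e) r) (k + 1)"
proof -
  define P :: "rat poly" where "P = (\<Prod>l = Suc e..<r. [:(- 1) ^ l, 1:])"
  have down: "down_poly e r = [:(- 1) ^ e, 1:] * (monom 1 e * P)"
    using assms by (simp add: down_poly_def P_def prod.atLeast_Suc_lessThan mult_ac)
  have down': "down_poly (Suc e) r = [:0, 1:] * (monom 1 e * P)"
    using assms by (simp add: down_poly_def P_def monom_Suc mult_ac)
  show ?thesis
    unfolding down down' zcoeff_mult_linear by simp
qed

lemma degree_down_poly: "degree (down_poly e r) \<le> r"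
proof -
  have "degree (\<Prod>l = e..<r. [:(- 1) ^ l, 1 :: rat:]) \<le> (\<Sum>l = e..<r. degree [:(- 1) ^ l, 1 :: rat:])"
    using degree_prod_sum_le[of "{e..<r}" "\<lambda>l. [:(- 1) ^ l, 1 :: rat:]"] by (simp add: o_def)
  also have "\<dots> = r - e" by simp
  finally have "degree (\<Prod>l = e..<r. [:(- 1) ^ l, 1 :: rat:]) \<le> r - e" .
  moreover have "degree (monom 1 (min e r) :: rat poly) \<le> min e r" by (rule degree_monom_le)
  ultimately show ?thesis
    unfolding down_poly_def by (intro order.trans[OF degree_mult_le]) linarith
qed

lemma minus_one_power_cong: "even a = even b \<Longrightarrow> (- 1) ^ a = ((- 1) ^ b :: 'a :: ring_1)"
  by (cases "even b") simp_all

lemma minus_one_power_square: "((- 1) ^ k)\<^sup>2 = (1 :: 'a :: ring_1)"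
  by (cases "even k") simp_all

text \<open>The sign in front absorbs the signs of the level steps, so that only a descent still
  carries a sign, \<open>(- 1) ^ e\<close>. The summand \<open>r * n\<close> makes it 1 at the end,
  where \<open>m = 0\<close> and \<open>p = r\<close>.\<close>

lemma path_sum_down:
  assumes "m \<le> n" "r \<le> n"
  shows "path_sum n m p r = (- 1) ^ (r * n + (n - m) * p) * zcoeff (down_poly (n - m) r) (2 * int r - int p)"
  using assms(1)
proof (induction m arbitrary: p)
  case 0
  have "(- 1) ^ (r * n + n * p) = (1 :: rat)" if "p = r"
  proof -
    have "even (r * n + n * p)" using that by auto
    then show ?thesis by (rule neg_one_even_power)
  qed
  then show ?case using assms(2) by (auto simp: down_poly_def zcoeff_def)
next
  case (Suc m)
  define e where "e = n - Suc m"
  have e: "n - m = Suc e" "Suc n - m = Suc (Suc e)" and "\<not> n \<le> m" using Suc.prems by (auto simp: e_def)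
  let ?z = "\<lambda>k. zcoeff (down_poly (Suc e) r) k"
  have "(- 1) ^ p * path_sum n m p r = (- 1) ^ (p + (r * n + Suc e * p)) * ?z (2 * int r - int p)"
    using Suc e by (simp add: power_add)
  also have "(- 1) ^ (p + (r * n + Suc e * p)) = ((- 1) ^ (r * n + e * p) :: rat)"
    by (rule minus_one_power_cong) auto
  finally have 1: "(- 1) ^ p * path_sum n m p r = (- 1) ^ (r * n + e * p) * ?z (2 * int r - int p)" .
  \<comment> \<open>The bound on \<open>p\<close> becomes the condition \<open>e < r\<close>. If
    \<open>e < r\<close>, a forbidden descent would land below \<open>r\<close>, and the degree
    bound makes its coefficient 0. If \<open>r\<close> is at most \<open>e\<close>, a permitted
    descent lands above \<open>r\<close>, and the later bounds keep the path there.\<close>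
  have 2: "(if Suc n - m \<le> p then (- 1) ^ (p - 1) * path_sum n m (p - 1) r else 0) =
    (if e < r then (- 1) ^ (r * n + e * p) * ((- 1) ^ e * ?z (2 * int r - int p + 1)) else 0)"
  proof (cases "Suc (Suc e) \<le> p")
    case True
    then obtain q where q: "p = Suc q" by (cases p) auto
    have "(- 1) ^ (p - 1) * path_sum n m (p - 1) r = (- 1) ^ (q + (r * n + Suc e * q)) * ?z (2 * int r - int q)"
      using Suc e by (simp add: power_add q)
    also have "(- 1) ^ (q + (r * n + Suc e * q)) = ((- 1) ^ (r * n + e * p + e) :: rat)"
      by (rule minus_one_power_cong) (auto simp: q)
    finally have "(- 1) ^ (p - 1) * path_sum n m (p - 1) r = (- 1) ^ (r * n + e * p) * ((- 1) ^ e * ?z (2 * int r - int p + 1))"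
      by (simp add: power_add q)
    moreover have "?z (2 * int r - int p + 1) = 0" if "\<not> e < r"
      using that True by (auto simp: down_poly_def zcoeff_def)
    ultimately show ?thesis using True e by auto
  next
    case False
    have "?z (2 * int r - int p + 1) = 0" if "e < r"
      using that False degree_down_poly[of "Suc e" r] by (auto simp: zcoeff_def intro!: coeff_eq_0)
    then show ?thesis using False e by auto
  qed
  have "path_sum n (Suc m) p r = (- 1) ^ (r * n + e * p) * zcoeff (down_poly e r) (2 * int r - int p)"
  proof (cases "e < r")
    case True
    then show ?thesis using \<open>\<not> n \<le> m\<close> 1 2 by (simp add: zcoeff_down_poly_rec algebra_simps)
  next
    case False
    then have "down_poly (Suc e) r = down_poly e r" by (simp add: down_poly_def)
    then show ?thesis using \<open>\<not> n \<le> m\<close> 1 2 False by simp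
  qed
  then show ?case by (simp add: e_def)
qed

text \<open>In the first half \<open>y\<close> marks the ascents. Ascents plus the level steps among
  the \<open>r\<close> free ones of the second half number \<open>2 * r - s\<close> for a path from
  \<open>s\<close> to \<open>r\<close>.\<close>

definition up_poly :: "nat \<Rightarrow> rat poly" where
  "up_poly d = (\<Prod>l = 1..d. [:1, (- 1) ^ l:])"

text \<open>With \<open>d \<le> p\<close> the lower bound on the height holds at each remaining step
  of the first half, so every ascent is allowed.\<close>

lemma path_sum_up:
  assumes "r \<le> n" "d \<le> p"
  shows "path_sum n (n + d) p r = (- 1) ^ (r * n + d * p) * zcoeff (up_poly d * down_poly 0 r) (2 * int r - int p)"
  using assms(2)
proof (induction d arbitrary: p)
  case 0
  then show ?case using path_sum_down[OF order.refl assms(1)] by (simp add: up_poly_def)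
next
  case (Suc d)
  let ?z = "\<lambda>k. zcoeff (up_poly d * down_poly 0 r) k"
  have up: "up_poly (Suc d) * down_poly 0 r = [:1, (- 1) ^ Suc d:] * (up_poly d * down_poly 0 r)"
    by (simp add: up_poly_def mult_ac)
  have "path_sum n (n + Suc d) p r = (- 1) ^ (p + (r * n + d * p)) * ?z (2 * int r - int p)
      + (- 1) ^ (Suc p + (r * n + d * Suc p)) * ?z (2 * int r - int p - 1)"
    using Suc.IH[of p] Suc.IH[of "Suc p"] Suc.prems by (simp add: power_add algebra_simps)
  also have "(- 1) ^ (p + (r * n + d * p)) = ((- 1) ^ (r * n + Suc d * p) :: rat)"
    by (rule minus_one_power_cong) auto
  also have "(- 1) ^ (Suc p + (r * n + d * Suc p)) = ((- 1) ^ (r * n + Suc d * p + Suc d) :: rat)"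
    by (rule minus_one_power_cong) auto
  finally show ?case unfolding up zcoeff_mult_linear by (simp add: power_add algebra_simps)
qed

lemma path_sum_full:
  assumes "r \<le> n" "s \<le> n"
  shows "path_sum n (2 * n) s r = (- 1) ^ (s * n + r * n) * zcoeff (up_poly s * down_poly 0 r) (2 * int r - int s)"
proof -
  \<comment> \<open>While more than \<open>s\<close> steps of the first half remain, height
    \<open>s\<close> violates the bound for an ascent; the path stays level and only collects
    signs.\<close>
  have "path_sum n (n + (s + d)) s r = (- 1) ^ (s * d) * path_sum n (n + s) s r" for d
    by (induction d) (auto simp: power_add)
  from this[of "n - s"] have "path_sum n (2 * n) s r = (- 1) ^ (s * (n - s)) * path_sum n (n + s) s r"
    using assms by (simp add: mult_2)
  also have "\<dots> = (- 1) ^ (s * (n - s) + (r * n + s * s)) * zcoeff (up_poly s * down_poly 0 r) (2 * int r - int s)"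
    using assms by (simp add: path_sum_up power_add)
  also have "(- 1) ^ (s * (n - s) + (r * n + s * s)) = ((- 1) ^ (s * n + r * n) :: rat)"
    using assms by (intro minus_one_power_cong) (auto simp: even_diff_nat)
  finally show ?thesis .
qed

section \<open>Parity of the entries and reduction to blocks\<close>

definition even_poly :: "rat poly" where "even_poly = [:1, 0, - 1:]"

text \<open>Two consecutive factors of \<open>up_poly\<close> or \<open>down_poly\<close> combine to
  this polynomial up to sign. It is even in \<open>y\<close>, so the parity of an exponent decides
  which coefficients vanish.\<close>

lemma even_poly_factor: "even_poly = [:1, 1:] * [:1, - 1:]"
  by (simp add: even_poly_def)

lemma up_poly_even: "up_poly (2 * a) = even_poly ^ a"
  by (induction a) (simp_all add: up_poly_def even_poly_factor mult_ac del: mult_pCons_left mult_pCons_right)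

lemma up_poly_odd: "up_poly (2 * a + 1) = [:1, - 1:] * even_poly ^ a"
  using up_poly_even[of a] by (simp add: up_poly_def mult_ac del: mult_pCons_left mult_pCons_right)

lemma down_poly_even: "down_poly 0 (2 * b) = smult ((- 1) ^ b) (even_poly ^ b)"
proof (induction b)
  case (Suc b)
  have "[:1, 1:] * [:- 1, 1:] = smult (- 1) even_poly" by (simp add: even_poly_def)
  moreover have "down_poly 0 (2 * Suc b) = down_poly 0 (2 * b) * ([:1, 1:] * [:- 1, 1:])"
    by (simp add: down_poly_def mult_ac del: mult_pCons_left mult_pCons_right)
  ultimately show ?case unfolding Suc by (simp add: mult_ac)
qed (simp add: down_poly_def)

lemma down_poly_odd: "down_poly 0 (2 * b + 1) = smult ((- 1) ^ b) ([:1, 1:] * even_poly ^ b)"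
proof -
  have "down_poly 0 (2 * b + 1) = [:1, 1:] * down_poly 0 (2 * b)"
    by (simp add: down_poly_def mult_ac del: mult_pCons_left mult_pCons_right)
  then show ?thesis unfolding down_poly_even by (simp only: mult_smult_right)
qed

definition zsign :: "int \<Rightarrow> rat" where "zsign k = (if even k then 1 else - 1)"

lemma zcoeff_even_poly:
  "zcoeff (even_poly ^ m) (2 * k) = zsign k * zbinom m k \<and> zcoeff (even_poly ^ m) (2 * k + 1) = 0"
proof (induction m arbitrary: k)
  case 0
  show ?case by (auto simp: zcoeff_def zbinom_0 zsign_def; presburger)
next
  case (Suc m)
  have "zcoeff (even_poly * P) l = zcoeff P l - zcoeff P (l - 2)" for P l
  proof -
    have "even_poly * P = [:1, 1:] * ([:1, - 1:] * P)" by (simp only: even_poly_factor mult.assoc)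
    then show ?thesis by (simp only: zcoeff_mult_linear) simp
  qed
  note rec = this
  have "2 * k - 2 = 2 * (k - 1)" "2 * k + 1 - 2 = 2 * (k - 1) + 1" by simp_all
  then show ?case
    unfolding power_Suc rec using Suc[of k] Suc[of "k - 1"]
    by (simp only: zbinom_Suc) (simp add: zsign_def algebra_simps)
qed

definition entry :: "nat \<Rightarrow> nat \<Rightarrow> rat" where
  "entry s r = zcoeff (up_poly s * down_poly 0 r) (2 * int r - int s)"

text \<open>The leftover factors \<open>1 - y\<close> and \<open>1 + y\<close> combine, so the
  product is even in \<open>y\<close>, while the exponent \<open>2 * r - s\<close> is odd.\<close>

lemma entry_odd_odd: "entry (2 * a + 1) (2 * b + 1) = 0"
proof -
  have "up_poly (2 * a + 1) * down_poly 0 (2 * b + 1) = smult ((- 1) ^ b) (even_poly ^ Suc (a + b))"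
  proof -
    have "even_poly ^ Suc (a + b) = [:1, 1:] * [:1, - 1:] * (even_poly ^ a * even_poly ^ b)"
      by (simp only: power_Suc power_add flip: even_poly_factor)
    then show ?thesis unfolding up_poly_odd down_poly_odd
      by (simp add: mult_ac del: mult_pCons_left mult_pCons_right)
  qed
  moreover have "2 * int (2 * b + 1) - int (2 * a + 1) = 2 * (2 * int b - int a) + 1" by simp
  ultimately show ?thesis unfolding entry_def by (simp only: zcoeff_smult zcoeff_even_poly mult_zero_right)
qed

text \<open>The exponent is even, so only the constant term of the leftover factor
  \<open>1 + y\<close> contributes; in \<open>entry_odd_even\<close> it is odd and only the linear
  term of \<open>1 - y\<close> does.\<close>

lemma entry_even_odd: "entry (2 * a) (2 * b + 1) = (- 1) ^ b * zsign (int a + 1) * zbinom (a + b) (2 * int b + 1 - int a)"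
proof -
  have 1: "up_poly (2 * a) * down_poly 0 (2 * b + 1) = smult ((- 1) ^ b) ([:1, 1:] * even_poly ^ (a + b))"
    unfolding up_poly_even down_poly_odd by (simp add: power_add mult_ac del: mult_pCons_left mult_pCons_right)
  have 2: "2 * int (2 * b + 1) - int (2 * a) = 2 * (2 * int b + 1 - int a)"
    "2 * (2 * int b + 1 - int a) - 1 = 2 * (2 * int b - int a) + 1" by simp_all
  have "zsign (2 * int b + 1 - int a) = zsign (int a + 1)" by (simp add: zsign_def)
  then show ?thesis unfolding entry_def 1 2(1) by (simp only: zcoeff_smult zcoeff_mult_linear 2(2) zcoeff_even_poly) simp
qed

lemma entry_odd_even: "entry (2 * a + 1) (2 * b) = (- 1) ^ b * zsign (int a) * zbinom (a + b) (2 * int b - int a - 1)"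
proof -
  have 1: "up_poly (2 * a + 1) * down_poly 0 (2 * b) = smult ((- 1) ^ b) ([:1, - 1:] * even_poly ^ (a + b))"
    unfolding up_poly_odd down_poly_even by (simp add: power_add mult_ac del: mult_pCons_left mult_pCons_right)
  have 2: "2 * int (2 * b) - int (2 * a + 1) = 2 * (2 * int b - int a - 1) + 1"
    "2 * (2 * int b - int a - 1) + 1 - 1 = 2 * (2 * int b - int a - 1)" by simp_all
  have "zsign (2 * int b - int a - 1) = - zsign (int a)" by (simp add: zsign_def)
  then show ?thesis unfolding entry_def 1 2(1) by (simp only: zcoeff_smult zcoeff_mult_linear 2(2) zcoeff_even_poly) simp
qed

lemma det_scale_conj:
  "det (mat n n (\<lambda>(i, j). c i * c j * f i j)) = (\<Prod>i<n. c i)\<^sup>2 * det (mat n n (\<lambda>(i, j). f i j :: 'a :: comm_ring_1))"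
proof -
  have "(\<Prod>i = 0..<n. c (p i)) = (\<Prod>i = 0..<n. c i)" if "p permutes {0..<n}" for p
    using prod.permute[OF that, of c] by (simp add: o_def)
  then show ?thesis
    by (auto simp: det_mat_Leibniz prod.distrib sum_distrib_left power2_eq_square mult_ac atLeast0LessThan intro!: sum.cong)
qed

text \<open>The sign in \<open>path_sum_full\<close> is a row factor times a column factor from the
  same sequence, so it enters the determinant as a square.\<close>

lemma det_path_sum:
  "det (mat n n (\<lambda>(i, j). path_sum n (2 * n) (Suc i) (Suc j))) = det (mat n n (\<lambda>(i, j). entry (Suc i) (Suc j)))"
proof -
  have "det (mat n n (\<lambda>(i, j). path_sum n (2 * n) (Suc i) (Suc j))) =
    det (mat n n (\<lambda>(i, j). (- 1) ^ (Suc i * n) * (- 1) ^ (Suc j * n) * entry (Suc i) (Suc j)))"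
    by (intro det_mat_cong) (simp add: path_sum_full entry_def power_add)
  also have "\<dots> = (\<Prod>i<n. (- 1) ^ (Suc i * n))\<^sup>2 * det (mat n n (\<lambda>(i, j). entry (Suc i) (Suc j)))"
    by (rule det_scale_conj)
  also have "(\<Prod>i<n. (- 1) ^ (Suc i * n))\<^sup>2 = (1 :: rat)"
    by (simp only: minus_one_power_square flip: power_sum)
  finally show ?thesis by simp
qed

text \<open>Pigeonhole: labels are \<open>Suc i\<close>, so the zero block sits at even indices. For
  \<open>n = 2 * k + 1\<close> there are \<open>k + 1\<close> of these but only \<open>k\<close> odd
  ones, hence every permutation meets the block.\<close>

lemma det_entry_odd:
  assumes "odd n"
  shows "det (mat n n (\<lambda>(i, j). entry (Suc i) (Suc j))) = 0"
  unfolding det_mat_Leibniz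
proof (intro sum.neutral ballI)
  fix p assume "p \<in> {p. p permutes {0..<n}}"
  then have p: "p permutes {0..<n}" by simp
  obtain k where n: "n = 2 * k + 1" using assms by (auto elim: oddE)
  have "\<exists>i<n. even i \<and> even (p i)"
  proof (rule ccontr)
    assume "\<not> ?thesis"
    then have odd: "odd (p (2 * i))" "p (2 * i) < n" if "i \<le> k" for i
      using that permutes_in_image[OF p, of "2 * i"] by (auto simp: n)
    have "p (2 * i) \<in> (\<lambda>i. 2 * i + 1) ` {..<k}" if "i \<le> k" for i
    proof -
      have "odd (p (2 * i))" by (rule odd(1)) (rule that)
      obtain l where "p (2 * i) = 2 * l + 1" using \<open>odd (p (2 * i))\<close> by (rule oddE)
      moreover from this have "l < k" using odd(2)[of i] that by (simp add: n)
      ultimately show ?thesis by blast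
    qed
    then have "p ` (\<lambda>i. 2 * i) ` {..k} \<subseteq> (\<lambda>i. 2 * i + 1) ` {..<k}" by blast
    then have "card (p ` (\<lambda>i. 2 * i) ` {..k}) \<le> card ((\<lambda>i. 2 * i + 1) ` {..<k})"
      by (intro card_mono) auto
    moreover have "card (p ` (\<lambda>i. 2 * i) ` {..k}) = Suc k"
    proof -
      have "card (p ` (\<lambda>i. 2 * i) ` {..k}) = card ((\<lambda>i. 2 * i) ` {..k})"
        using permutes_inj_on[OF p] by (rule card_image)
      also have "\<dots> = card {..k}" by (rule card_image) (simp add: inj_on_def)
      finally show ?thesis by simp
    qed
    moreover have "card ((\<lambda>i. 2 * i + 1) ` {..<k}) = k" by (simp add: card_image inj_on_def)
    ultimately show False by simp
  qed
  then obtain i a b where "i < n" "i = 2 * a" "p i = 2 * b" by (auto elim!: evenE)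
  then have "(\<Prod>i = 0..<n. entry (Suc i) (Suc (p i))) = 0"
    using entry_odd_odd[of a b] by (intro prod_zero) (auto intro!: bexI[of _ i])
  then show "signof p * (\<Prod>i = 0..<n. entry (Suc i) (Suc (p i))) = 0" by simp
qed

lemma det_relabel:
  assumes "q permutes {0..<n}"
  shows "det (mat n n (\<lambda>(i, j). f (q i) (q j))) = det (mat n n (\<lambda>(i, j). f i j :: 'a :: comm_ring_1))"
proof -
  have q: "q i < n" if "i < n" for i using permutes_in_image[OF assms, of i] that by simp
  define A where "A = mat n n (\<lambda>(i, j). f i j)"
  define B where "B = mat n n (\<lambda>(i, j). f (q i) j)"
  have "B = mat n n (\<lambda>(i, j). A $$ (q i, j))" by (auto simp: A_def B_def q)
  then have B: "det B = signof q * det A" using det_permute_rows[OF _ assms, of A] by (simp add: A_def)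
  have "transpose_mat (mat n n (\<lambda>(i, j). f (q i) (q j))) = mat n n (\<lambda>(i, j). transpose_mat B $$ (q i, j))"
    by (auto simp: B_def q)
  then have "det (mat n n (\<lambda>(i, j). f (q i) (q j))) = signof q * det (transpose_mat B)"
    using det_permute_rows[OF _ assms, of "transpose_mat B"] det_transpose[of "mat n n (\<lambda>(i, j). f (q i) (q j))" n]
    by (simp add: B_def)
  also have "det (transpose_mat B) = det B" by (rule det_transpose[of _ n]) (simp add: B_def)
  also have "signof q * det B = signof q * signof q * det A" by (simp add: B)
  also have "signof q * signof q = (1 :: 'a)" by (simp add: sign_def)
  finally show ?thesis by (simp add: A_def)
qed

lemma det_entry_even:
  "det (mat (2 * m) (2 * m) (\<lambda>(i, j). entry (Suc i) (Suc j))) = (det (mrr_mat m))\<^sup>2"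
proof -
  \<comment> \<open>\<open>q\<close> lists the odd indices first, that is the even labels, which
    puts the zero block at the lower right.\<close>
  define q where "q i = (if i < m then 2 * i + 1 else if i < 2 * m then 2 * (i - m) else i)" for i
  have "inj_on q {0..<2 * m}"
    by (auto simp: inj_on_def q_def split: if_splits) presburger+
  moreover have "q ` {0..<2 * m} \<subseteq> {0..<2 * m}" by (auto simp: q_def)
  ultimately have "bij_betw q {0..<2 * m} {0..<2 * m}"
    by (metis bij_betw_def endo_inj_surj finite_atLeastLessThan)
  then have q: "q permutes {0..<2 * m}" by (intro bij_imp_permutes) (auto simp: q_def)
  define EE where "EE = mat m m (\<lambda>(i, j). entry (2 * (i + 1)) (2 * (j + 1)))"
  define EO where "EO = mat m m (\<lambda>(i, j). entry (2 * (i + 1)) (2 * j + 1))"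
  define OE where "OE = mat m m (\<lambda>(i, j). entry (2 * i + 1) (2 * (j + 1)))"
  note defs = EE_def EO_def OE_def
  have carr: "EE \<in> carrier_mat m m" "EO \<in> carrier_mat m m" "OE \<in> carrier_mat m m" by (auto simp: defs)
  have "mat (2 * m) (2 * m) (\<lambda>(i, j). entry (Suc (q i)) (Suc (q j))) = four_block_mat EE EO OE (0\<^sub>m m m)"
    using entry_odd_odd by (intro eq_matI) (auto simp: defs q_def)
  then have "det (mat (2 * m) (2 * m) (\<lambda>(i, j). entry (Suc i) (Suc j))) = det (four_block_mat EE EO OE (0\<^sub>m m m))"
    using det_relabel[OF q, of "\<lambda>i j. entry (Suc i) (Suc j)"] by simp
  also have "\<dots> = det (EE * 0\<^sub>m m m - EO * OE)"
    by (rule det_four_block_mat) (use carr in auto)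
  also have "EE * 0\<^sub>m m m - EO * OE = - 1 \<cdot>\<^sub>m (EO * OE)"
    using carr by (intro eq_matI) auto
  \<comment> \<open>This \<open>(- 1) ^ m\<close> cancels against the one in
    \<open>det OE\<close>.\<close>
  also have "det \<dots> = (- 1) ^ m * (det EO * det OE)"
    using carr det_mult[OF carr(2,3)] by simp
  also have "det EO = det (mrr_mat m)"
  proof -
    have "det EO = det (mat m m (\<lambda>(i, j). (- 1) ^ i * (- 1) ^ j * zbinom (i + j + 1) (2 * int j - int i)))"
      unfolding EO_def by (intro det_mat_cong) (simp only: entry_even_odd, simp add: zsign_def)
    also have "\<dots> = (\<Prod>i<m. (- 1) ^ i)\<^sup>2 * det (mrr_mat m)"
      unfolding mrr_mat_def by (rule det_scale_conj)
    finally show ?thesis by (simp only: minus_one_power_square mult_1 flip: power_sum)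
  qed
  also have "det OE = (- 1) ^ m * det (mrr_mat m)"
  proof -
    have "det OE = det (mat m m (\<lambda>(i, j). (- 1) ^ i * (- 1) ^ j * (- 1 * zbinom (i + j + 1) (2 * int i - int j))))"
      unfolding OE_def
    proof (intro det_mat_cong)
      fix i j :: nat
      \<comment> \<open>Binomial symmetry exchanges the roles of \<open>i\<close> and
        \<open>j\<close>, so \<open>OE\<close> is minus the transpose of \<open>mrr_mat\<close> up
        to row and column signs.\<close>
      have "zbinom (i + (j + 1)) (2 * int (j + 1) - int i - 1) = zbinom (i + j + 1) (2 * int i - int j)"
        by (subst zbinom_sym) simp
      then show "entry (2 * i + 1) (2 * (j + 1)) = (- 1) ^ i * (- 1) ^ j * (- 1 * zbinom (i + j + 1) (2 * int i - int j))"
        by (simp only: entry_odd_even) (simp add: zsign_def)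
    qed
    also have "\<dots> = (\<Prod>i<m. (- 1) ^ i)\<^sup>2 * det (mat m m (\<lambda>(i, j). - 1 * zbinom (i + j + 1) (2 * int i - int j)))"
      by (rule det_scale_conj)
    also have "(\<Prod>i<m. (- 1) ^ i)\<^sup>2 = (1 :: rat)" by (simp only: minus_one_power_square flip: power_sum)
    also have "det (mat m m (\<lambda>(i, j). - 1 * zbinom (i + j + 1) (2 * int i - int j))) =
      (\<Prod>i<m. - 1) * det (mat m m (\<lambda>(i, j). zbinom (i + j + 1) (2 * int i - int j)))"
      by (rule det_scale_rows)
    also have "mat m m (\<lambda>(i, j). zbinom (i + j + 1) (2 * int i - int j)) = transpose_mat (mrr_mat m)"
      by (auto simp: mrr_mat_def add.commute)
    also have "det (transpose_mat (mrr_mat m)) = det (mrr_mat m)"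
      by (rule det_transpose[of _ m]) (simp add: mrr_mat_def)
    finally show ?thesis by simp
  qed
  finally show ?thesis by (simp add: power2_eq_square)
qed

theorem family_sum_eval:
  "family_sum n (2 * n) (\<lambda>_. 0) =
     (if even n then (\<Prod>k = 1..n div 2. fact (6 * k - 2) / fact (2 * k + n))\<^sup>2 else 0)"
proof -
  have *: "family_sum n (2 * n) (\<lambda>_. 0) = det (mat n n (\<lambda>(i, j). entry (Suc i) (Suc j)))"
    using family_sum_det[of n "\<lambda>_. 0" "2 * n"] by (simp add: det_path_sum)
  show ?thesis
  proof (cases "even n")
    case True
    then obtain m where "n = 2 * m" by (auto elim: evenE)
    then show ?thesis using * by (simp add: det_entry_even det_mrr_mat)
  qed (simp add: * det_entry_odd)
qed

section \<open>Plane partitions and chains of partitions\<close>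

text \<open>A chain of \<open>n\<close> partitions, level \<open>s\<close> lying in an \<open>s \<times> s\<close> box; rows and columns are
  numbered from 0, levels from 1.\<close>

definition stack :: "nat \<Rightarrow> (nat \<times> nat \<times> nat) set \<Rightarrow> bool" where
  "stack n R \<longleftrightarrow>
     (\<forall>a b s. (a, b, s) \<in> R \<longrightarrow> a < s \<and> b < s \<and> s \<le> n) \<and>
     (\<forall>a b s a' b' s'. (a, b, s) \<in> R \<and> a' \<le> a \<and> b' \<le> b \<and> s \<le> s' \<and> s' \<le> n \<longrightarrow> (a', b', s') \<in> R)"

lemma stackD:
  assumes "stack n R"
  shows "(a, b, s) \<in> R \<Longrightarrow> a < s" "(a, b, s) \<in> R \<Longrightarrow> b < s" "(a, b, s) \<in> R \<Longrightarrow> s \<le> n"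
    and "(a, b, s) \<in> R \<Longrightarrow> a' \<le> a \<Longrightarrow> b' \<le> b \<Longrightarrow> s \<le> s' \<Longrightarrow> s' \<le> n \<Longrightarrow> (a', b', s') \<in> R"
  using assms unfolding stack_def by blast+

text \<open>With \<open>\<alpha> = n + 1\<close>, a coordinate \<open>i\<close> is described by its distance from the middle of the box,
  \<open>n + 1 - i\<close> below and \<open>i - (n + 2)\<close> above; reflection in the middle preserves it.\<close>

definition holes :: "nat \<Rightarrow> point set \<Rightarrow> (nat \<times> nat \<times> nat) set" where
  "holes n P = {(a, b, s). a < s \<and> b < s \<and> s \<le> n \<and> (Suc n - a, Suc n - b, n + 2 + s) \<notin> P}"

text \<open>The cases go by the number of coordinates above the middle. One above is rotated to the
  last place; two above are reflected to one above, where the transposition swaps the first two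
  entries of the triple.\<close>

definition fill_mem :: "nat \<Rightarrow> (nat \<times> nat \<times> nat) set \<Rightarrow> nat \<Rightarrow> nat \<Rightarrow> nat \<Rightarrow> bool" where
  "fill_mem n R i j k =
    (if i \<le> Suc n then
       if j \<le> Suc n then
         if k \<le> Suc n then True else (Suc n - i, Suc n - j, k - (n + 2)) \<notin> R
       else if k \<le> Suc n then (Suc n - k, Suc n - i, j - (n + 2)) \<notin> R
            else (k - (n + 2), j - (n + 2), Suc n - i) \<in> R
     else if j \<le> Suc n then
       if k \<le> Suc n then (Suc n - j, Suc n - k, i - (n + 2)) \<notin> R
       else (i - (n + 2), k - (n + 2), Suc n - j) \<in> R
     else if k \<le> Suc n then (j - (n + 2), i - (n + 2), Suc n - k) \<in> R else False)"

definition fill :: "nat \<Rightarrow> (nat \<times> nat \<times> nat) set \<Rightarrow> point set" where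
  "fill n R = {(i, j, k) \<in> cube (2 * Suc n). fill_mem n R i j k}"

lemma fill_mem_rotate: "fill_mem n R j k i = fill_mem n R i j k"
  unfolding fill_mem_def by auto

lemma fill_mem_decrease:
  assumes R: "stack n R" and "fill_mem n R (Suc i) j k" and "0 < i" "Suc i \<le> 2 * Suc n"
    "0 < j" "j \<le> 2 * Suc n" "0 < k" "k \<le> 2 * Suc n"
  shows "fill_mem n R i j k"
proof -
  note c = stackD[OF R]
  consider "Suc i \<le> Suc n" | "i = Suc n" | "i > Suc n" by linarith
  then show ?thesis
  proof cases
    case 1
    have "n - i \<le> Suc n - i" "k - (n + 2) \<le> n" "j - (n + 2) \<le> n" "Suc n - i \<le> n"
      using assms(3-) by auto
    with 1 show ?thesis
      using assms(2-) c(4)[of "Suc n - i" "Suc n - j" "k - (n + 2)" "n - i" "Suc n - j" "k - (n + 2)"]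
        c(4)[of "Suc n - k" "Suc n - i" "j - (n + 2)" "Suc n - k" "n - i" "j - (n + 2)"]
        c(4)[of "k - (n + 2)" "j - (n + 2)" "n - i" "k - (n + 2)" "j - (n + 2)" "Suc n - i"]
      by (auto simp: fill_mem_def split: if_splits)
  next
    case 2
    \<comment> \<open>Crossing the middle: if the triples tested before and after were both in
      \<open>R\<close>, they would give opposite strict inequalities between the same two
      distances.\<close>
    then show ?thesis
      using assms(2-) c(1)[of 0 "k - (n + 2)" "Suc n - j"] c(2)[of 0 "k - (n + 2)" "Suc n - j"]
        c(2)[of 0 "Suc n - j" "k - (n + 2)"]
        c(1)[of "j - (n + 2)" 0 "Suc n - k"] c(1)[of "Suc n - k" 0 "j - (n + 2)"]
      by (auto simp: fill_mem_def split: if_splits)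
  next
    case 3
    have "i - (n + 2) \<le> Suc i - (n + 2)" "Suc i - (n + 2) \<le> n" "Suc n - j \<le> n" "Suc n - k \<le> n"
      using assms(3-) by auto
    with 3 show ?thesis
      using assms(2-)
        c(4)[of "Suc n - j" "Suc n - k" "i - (n + 2)" "Suc n - j" "Suc n - k" "Suc i - (n + 2)"]
        c(4)[of "Suc i - (n + 2)" "k - (n + 2)" "Suc n - j" "i - (n + 2)" "k - (n + 2)" "Suc n - j"]
        c(4)[of "j - (n + 2)" "Suc i - (n + 2)" "Suc n - k" "j - (n + 2)" "i - (n + 2)" "Suc n - k"]
      by (auto simp: fill_mem_def split: if_splits)
  qed
qed

lemma fill_mem_decrease_le:
  assumes R: "stack n R" and "fill_mem n R i j k" and "0 < i'" "i' \<le> i" "i \<le> 2 * Suc n"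
    "0 < j" "j \<le> 2 * Suc n" "0 < k" "k \<le> 2 * Suc n"
  shows "fill_mem n R i' j k"
  using assms(4)
proof (induction rule: inc_induct)
  case (step m)
  then show ?case using fill_mem_decrease[OF R step.IH] assms by simp
qed (rule assms(2))

lemma fill_mem_transpose_complement:
  assumes "0 < i" "i \<le> 2 * Suc n" "0 < j" "j \<le> 2 * Suc n" "0 < k" "k \<le> 2 * Suc n"
  shows "fill_mem n R (2 * Suc n + 1 - j) (2 * Suc n + 1 - i) (2 * Suc n + 1 - k) \<longleftrightarrow> \<not> fill_mem n R i j k"
proof -
  have 1: "2 * Suc n + 1 - i \<le> Suc n \<longleftrightarrow> \<not> i \<le> Suc n" for i by auto
  have 2: "Suc n - (2 * Suc n + 1 - i) = i - (n + 2)" if "i \<le> 2 * Suc n" for i using that by auto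
  have 3: "2 * Suc n + 1 - i - (n + 2) = Suc n - i" for i by auto
  show ?thesis unfolding fill_mem_def 1 2[OF assms(2)] 2[OF assms(4)] 2[OF assms(6)] 3 by auto
qed

lemma fill_in_CSTCPP:
  assumes R: "stack n R"
  shows "fill n R \<in> CSTCPP (Suc n)"
proof -
  have "plane_partition (fill n R)"
    unfolding plane_partition_def
  proof (intro conjI allI impI)
    show "finite (fill n R)"
      by (rule finite_subset[of _ "cube (2 * Suc n)"]) (auto simp: fill_def cube_def)
  next
    fix i j k i' j' k'
    assume h: "(i, j, k) \<in> fill n R \<and> 1 \<le> i' \<and> i' \<le> i \<and> 1 \<le> j' \<and> j' \<le> j \<and> 1 \<le> k' \<and> k' \<le> k"
    then have b: "0 < i" "i \<le> 2 * Suc n" "0 < j" "j \<le> 2 * Suc n" "0 < k" "k \<le> 2 * Suc n" "fill_mem n R i j k"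
      by (auto simp: fill_def cube_def)
    \<comment> \<open>Rotations bring each coordinate to the front in turn to be lowered.\<close>
    have "fill_mem n R i' j k" using fill_mem_decrease_le[OF R b(7)] h b by simp
    then have "fill_mem n R j k i'" by (simp only: fill_mem_rotate)
    then have "fill_mem n R j' k i'" using fill_mem_decrease_le[OF R] h b by simp
    then have "fill_mem n R k i' j'" by (simp only: fill_mem_rotate)
    then have "fill_mem n R k' i' j'" using fill_mem_decrease_le[OF R] h b by simp
    then have "fill_mem n R i' j' k'" by (simp only: fill_mem_rotate)
    then show "(i', j', k') \<in> fill n R" using h b by (auto simp: fill_def cube_def)
  qed (auto simp: fill_def cube_def)
  moreover have "cyclically_symmetric (fill n R)"
    unfolding cyclically_symmetric_def rho_def by (auto simp: fill_def cube_def fill_mem_rotate)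
  moreover have "transpose_complementary (2 * Suc n) (fill n R)"
    unfolding transpose_complementary_def
  proof (intro ballI)
    fix i j k assume h: "i \<in> {1..2 * Suc n}" "j \<in> {1..2 * Suc n}" "k \<in> {1..2 * Suc n}"
    then have "(2 * Suc n + 1 - j, 2 * Suc n + 1 - i, 2 * Suc n + 1 - k) \<in> cube (2 * Suc n)" "(i, j, k) \<in> cube (2 * Suc n)"
      by (auto simp: cube_def)
    then show "(i, j, k) \<in> fill n R \<longleftrightarrow> (2 * Suc n + 1 - j, 2 * Suc n + 1 - i, 2 * Suc n + 1 - k) \<notin> fill n R"
      using fill_mem_transpose_complement[of i n j k R] h by (auto simp: fill_def)
  qed
  ultimately show ?thesis by (auto simp: CSTCPP_def fill_def)
qed

lemma holes_fill:
  assumes R: "stack n R"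
  shows "holes n (fill n R) = R"
  using stackD(1-3)[OF R] by (auto simp: holes_def fill_def cube_def fill_mem_def)

lemma orbit_rho: "orbit rho (i, j, k) = {(i, j, k), (j, k, i), (k, i, j)}"
proof -
  have "orbit rho (i, j, k) \<subseteq> {(i, j, k), (j, k, i), (k, i, j)}"
  proof
    fix p assume "p \<in> orbit rho (i, j, k)"
    then show "p \<in> {(i, j, k), (j, k, i), (k, i, j)}" by induction (auto simp: rho_def)
  qed
  moreover have "(j, k, i) \<in> orbit rho (i, j, k)"
    using orbit.base[of rho "(i, j, k)"] by (simp add: rho_def)
  moreover from orbit.step[OF this] have "(k, i, j) \<in> orbit rho (i, j, k)" by (simp add: rho_def)
  moreover from orbit.step[OF this] have "(i, j, k) \<in> orbit rho (i, j, k)" by (simp add: rho_def)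
  ultimately show ?thesis by blast
qed

section \<open>A given plane partition, recovered from its holes\<close>

context
  fixes n :: nat and P :: "point set"
  assumes P: "P \<in> CSTCPP (Suc n)"
begin

lemma CSTCPP_mono:
  "(i, j, k) \<in> P \<Longrightarrow> 1 \<le> i' \<Longrightarrow> i' \<le> i \<Longrightarrow> 1 \<le> j' \<Longrightarrow> j' \<le> j \<Longrightarrow> 1 \<le> k' \<Longrightarrow> k' \<le> k \<Longrightarrow> (i', j', k') \<in> P"
  using P unfolding CSTCPP_def plane_partition_def by blast

lemma CSTCPP_rotate: "(j, k, i) \<in> P \<longleftrightarrow> (i, j, k) \<in> P"
proof -
  have "(i, j, k) \<in> P \<Longrightarrow> (j, k, i) \<in> P" for i j k
    using P unfolding CSTCPP_def cyclically_symmetric_def rho_def by fastforce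
  then show ?thesis by blast
qed

lemma CSTCPP_complement:
  "1 \<le> i \<Longrightarrow> i \<le> 2 * Suc n \<Longrightarrow> 1 \<le> j \<Longrightarrow> j \<le> 2 * Suc n \<Longrightarrow> 1 \<le> k \<Longrightarrow> k \<le> 2 * Suc n \<Longrightarrow>
   (i, j, k) \<in> P \<longleftrightarrow> (2 * Suc n + 1 - j, 2 * Suc n + 1 - i, 2 * Suc n + 1 - k) \<notin> P"
  using P unfolding CSTCPP_def transpose_complementary_def by auto

text \<open>On the plane \<open>i + k = 2 * \<alpha> + 1\<close> complementation followed by a rotation only reflects \<open>j\<close>, so the lower half of
  the plane lies in \<open>P\<close>.\<close>

lemma CSTCPP_forced:
  assumes "1 \<le> i" "1 \<le> j" "1 \<le> k" "i + k \<le> 2 * Suc n + 1" "j \<le> Suc n"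
  shows "(i, j, k) \<in> P"
proof -
  define k' where "k' = 2 * Suc n + 1 - i"
  have k': "1 \<le> k'" "k' \<le> 2 * Suc n" "k \<le> k'" "2 * Suc n + 1 - k' = i" "2 * Suc n + 1 - i = k'" "i \<le> 2 * Suc n"
    using assms by (auto simp: k'_def)
  have "(k', i, j) \<in> P"
  proof (rule ccontr)
    assume "(k', i, j) \<notin> P"
    then have "(k', i, 2 * Suc n + 1 - j) \<in> P"
      using CSTCPP_complement[of k' i j] assms k' by simp
    then have "(k', i, j) \<in> P" by (rule CSTCPP_mono) (use assms k' in auto)
    then show False using \<open>(k', i, j) \<notin> P\<close> by blast
  qed
  then have "(i, j, k') \<in> P" by (simp only: CSTCPP_rotate)
  then show ?thesis by (rule CSTCPP_mono) (use assms k' in auto)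
qed

text \<open>The restrictions \<open>a < s\<close> and \<open>b < s\<close> in \<open>holes\<close>
  lose nothing: where one fails, \<open>CSTCPP_forced\<close> puts the point or its rotation in
  \<open>P\<close>.\<close>

lemma CSTCPP_one_above:
  assumes "1 \<le> i" "i \<le> Suc n" "1 \<le> j" "j \<le> Suc n" "Suc n < k" "k \<le> 2 * Suc n"
  shows "(i, j, k) \<in> P \<longleftrightarrow> (Suc n - i, Suc n - j, k - (n + 2)) \<notin> holes n P"
proof -
  have e: "Suc n - (Suc n - i) = i" "Suc n - (Suc n - j) = j" "n + 2 + (k - (n + 2)) = k" using assms by auto
  have "(i, j, k) \<in> P" if "k - (n + 2) \<le> Suc n - i"
    using that assms by (intro CSTCPP_forced) auto
  moreover have "(i, j, k) \<in> P" if "k - (n + 2) \<le> Suc n - j"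
  proof -
    have "(k, i, j) \<in> P" using that assms by (intro CSTCPP_forced) auto
    then show ?thesis by (simp only: CSTCPP_rotate)
  qed
  moreover have "k - (n + 2) \<le> n" using assms by auto
  ultimately show ?thesis unfolding holes_def mem_Collect_eq case_prod_conv e by (auto simp: not_less)
qed

lemma CSTCPP_two_above:
  assumes "1 \<le> i" "i \<le> Suc n" "Suc n < j" "j \<le> 2 * Suc n" "Suc n < k" "k \<le> 2 * Suc n"
  shows "(i, j, k) \<in> P \<longleftrightarrow> (k - (n + 2), j - (n + 2), Suc n - i) \<in> holes n P"
proof -
  have "(i, j, k) \<in> P \<longleftrightarrow> (2 * Suc n + 1 - k, 2 * Suc n + 1 - j, 2 * Suc n + 1 - i) \<notin> P"
    using CSTCPP_complement[of i j k] CSTCPP_rotate[of "2 * Suc n + 1 - j" "2 * Suc n + 1 - i" "2 * Suc n + 1 - k"] assms by simp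
  also have "\<dots> \<longleftrightarrow> (Suc n - (2 * Suc n + 1 - k), Suc n - (2 * Suc n + 1 - j), 2 * Suc n + 1 - i - (n + 2)) \<in> holes n P"
    using assms by (subst CSTCPP_one_above) auto
  also have "Suc n - (2 * Suc n + 1 - k) = k - (n + 2)" using assms by simp
  also have "Suc n - (2 * Suc n + 1 - j) = j - (n + 2)" using assms by simp
  also have "2 * Suc n + 1 - i - (n + 2) = Suc n - i" by simp
  finally show ?thesis .
qed

text \<open>The transpose-complementary image has all coordinates in the lower half and is
  forced.\<close>

lemma CSTCPP_three_above:
  assumes "Suc n < i" "i \<le> 2 * Suc n" "Suc n < j" "j \<le> 2 * Suc n" "Suc n < k" "k \<le> 2 * Suc n"
  shows "(i, j, k) \<notin> P"
proof -
  have "(2 * Suc n + 1 - j, 2 * Suc n + 1 - i, 2 * Suc n + 1 - k) \<in> P"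
    using assms by (intro CSTCPP_forced) auto
  then show ?thesis using CSTCPP_complement[of i j k] assms by simp
qed

lemma stack_holes: "stack n (holes n P)"
  unfolding stack_def
proof (intro conjI allI impI)
  fix a b s a' b' s'
  assume h: "(a, b, s) \<in> holes n P \<and> a' \<le> a \<and> b' \<le> b \<and> s \<le> s' \<and> s' \<le> n"
  then have "(Suc n - a, Suc n - b, n + 2 + s) \<notin> P" "a < s" "b < s" by (auto simp: holes_def)
  moreover have "(Suc n - a, Suc n - b, n + 2 + s) \<in> P" if "(Suc n - a', Suc n - b', n + 2 + s') \<in> P"
    by (rule CSTCPP_mono[OF that]) (use h \<open>a < s\<close> \<open>b < s\<close> in auto)
  ultimately show "(a', b', s') \<in> holes n P" using h by (auto simp: holes_def)
qed (auto simp: holes_def)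

lemma fill_holes: "fill n (holes n P) = P"
proof -
  have "fill_mem n (holes n P) i j k \<longleftrightarrow> (i, j, k) \<in> P" if "(i, j, k) \<in> cube (2 * Suc n)" for i j k
  proof -
    have b: "1 \<le> i" "i \<le> 2 * Suc n" "1 \<le> j" "j \<le> 2 * Suc n" "1 \<le> k" "k \<le> 2 * Suc n"
      using that by (auto simp: cube_def)
    have rot: "(j, k, i) \<in> P \<longleftrightarrow> (i, j, k) \<in> P" "(k, i, j) \<in> P \<longleftrightarrow> (i, j, k) \<in> P" by (simp_all only: CSTCPP_rotate)
    show ?thesis
      unfolding fill_mem_def
      using b rot CSTCPP_one_above[of i j k] CSTCPP_one_above[of k i j] CSTCPP_one_above[of j k i]
        CSTCPP_two_above[of i j k] CSTCPP_two_above[of k i j] CSTCPP_two_above[of j k i]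
        CSTCPP_three_above[of i j k] CSTCPP_forced[of i j k]
      by (simp split: if_split)
  qed
  moreover have "P \<subseteq> cube (2 * Suc n)" using P by (auto simp: CSTCPP_def)
  ultimately show ?thesis by (auto simp: fill_def)
qed

text \<open>An orbit in \<open>P\<close> but not in \<open>P0\<close> has exactly two coordinates
  above the middle. Its unique member with the low coordinate first corresponds to a hole by
  complementation.\<close>

lemma n_orbits_eq_card_holes: "n_orbits (Suc n) P = card (holes n P)"
proof -
  define g where "g = (\<lambda>(a, b, s). orbit rho (Suc n - s, n + 2 + b, n + 2 + a))"
  have "inj_on g (holes n P)"
  proof (rule inj_onI)
    fix p q assume pq: "p \<in> holes n P" "q \<in> holes n P" "g p = g q"
    obtain a b s a' b' s' where e: "p = (a, b, s)" "q = (a', b', s')" by (cases p, cases q) auto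
    have "(Suc n - s, n + 2 + b, n + 2 + a) \<in> g p" by (simp add: g_def e orbit_rho)
    then have "(Suc n - s, n + 2 + b, n + 2 + a) \<in> orbit rho (Suc n - s', n + 2 + b', n + 2 + a')"
      using pq(3) by (simp add: g_def e)
    then show "p = q" using pq(1,2) by (auto simp: e orbit_rho holes_def)
  qed
  moreover have "g ` holes n P = {Q \<in> range (orbit rho). Q \<subseteq> P \<and> \<not> Q \<subseteq> P0 (Suc n)}"
  proof (intro equalityI subsetI)
    fix Q assume "Q \<in> g ` holes n P"
    then obtain a b s where Q: "Q = orbit rho (Suc n - s, n + 2 + b, n + 2 + a)" and h: "(a, b, s) \<in> holes n P"
      by (auto simp: g_def)
    have s: "a < s" "b < s" "s \<le> n" using h by (auto simp: holes_def)
    have "(Suc n - s, n + 2 + b, n + 2 + a) \<in> P"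
      using CSTCPP_two_above[of "Suc n - s" "n + 2 + b" "n + 2 + a"] h s by simp
    then have "Q \<subseteq> P" unfolding Q orbit_rho using CSTCPP_rotate by blast
    moreover have "\<not> Q \<subseteq> P0 (Suc n)" unfolding Q orbit_rho by (auto simp: P0_def)
    ultimately show "Q \<in> {Q \<in> range (orbit rho). Q \<subseteq> P \<and> \<not> Q \<subseteq> P0 (Suc n)}" by (auto simp: Q)
  next
    fix Q assume "Q \<in> {Q \<in> range (orbit rho). Q \<subseteq> P \<and> \<not> Q \<subseteq> P0 (Suc n)}"
    then obtain p where "Q = orbit rho p" and "Q \<subseteq> P" "\<not> Q \<subseteq> P0 (Suc n)" by blast
    then obtain x y z where Q: "Q = {(x, y, z), (y, z, x), (z, x, y)}"
      by (cases p) (simp add: orbit_rho)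
    have rot: "Q = orbit rho (x, y, z)" "Q = orbit rho (y, z, x)" "Q = orbit rho (z, x, y)"
      unfolding Q orbit_rho by auto
    have c: "1 \<le> x" "x \<le> 2 * Suc n" "1 \<le> y" "y \<le> 2 * Suc n" "1 \<le> z" "z \<le> 2 * Suc n"
      using \<open>Q \<subseteq> P\<close> P by (auto simp: Q CSTCPP_def cube_def)
    have p: "(x, y, z) \<in> P" "(y, z, x) \<in> P" "(z, x, y) \<in> P" using \<open>Q \<subseteq> P\<close> by (auto simp: Q)
    have key: "Q \<in> g ` holes n P"
      if "Q = orbit rho (i, j, k)" "(i, j, k) \<in> P" "1 \<le> i" "i \<le> Suc n" "Suc n < j" "j \<le> 2 * Suc n" "Suc n < k" "k \<le> 2 * Suc n" for i j k
    proof -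
      have "(k - (n + 2), j - (n + 2), Suc n - i) \<in> holes n P" using CSTCPP_two_above[of i j k] that by simp
      moreover have "Suc n - (Suc n - i) = i" "n + 2 + (j - (n + 2)) = j" "n + 2 + (k - (n + 2)) = k"
        using that by auto
      then have "g (k - (n + 2), j - (n + 2), Suc n - i) = Q" by (simp only: g_def case_prod_conv that(1))
      ultimately show ?thesis by (metis image_eqI)
    qed
    have "\<not> (x \<le> Suc n \<and> y \<le> Suc n)" if "z \<le> Suc n"
      using that \<open>\<not> Q \<subseteq> P0 (Suc n)\<close> c by (auto simp: Q P0_def cube_def)
    moreover have "(Suc n < x \<and> Suc n < y) \<or> (Suc n < x \<and> Suc n < z) \<or> (Suc n < y \<and> Suc n < z)"
      using \<open>\<not> Q \<subseteq> P0 (Suc n)\<close> c by (auto simp: Q P0_def cube_def)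
    moreover have "\<not> (Suc n < x \<and> Suc n < y \<and> Suc n < z)"
      using CSTCPP_three_above[of x y z] p c by auto
    ultimately consider "x \<le> Suc n" "Suc n < y" "Suc n < z" | "y \<le> Suc n" "Suc n < z" "Suc n < x"
      | "z \<le> Suc n" "Suc n < x" "Suc n < y" by linarith
    then show "Q \<in> g ` holes n P"
      by cases (use key[OF rot(1) p(1)] key[OF rot(2) p(2)] key[OF rot(3) p(3)] c in auto)
  qed
  ultimately show ?thesis unfolding n_orbits_def by (metis card_image)
qed

end

lemma sum_CSTCPP_eq_sum_stack:
  "(\<Sum>P\<in>CSTCPP (Suc n). f (n_orbits (Suc n) P)) = (\<Sum>R | stack n R. f (card R))"
  by (rule sum.reindex_bij_witness[of _ "fill n" "holes n"])
    (auto simp: fill_holes stack_holes holes_fill fill_in_CSTCPP n_orbits_eq_card_holes)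

section \<open>Chains of partitions and path families\<close>

text \<open>\<open>x t\<close> is the state after \<open>t\<close> steps; the value 0 past time
  \<open>m\<close> makes the function determined by the walk.\<close>

definition families :: "nat \<Rightarrow> nat \<Rightarrow> (nat \<Rightarrow> nat) \<Rightarrow> (nat \<Rightarrow> nat \<Rightarrow> nat) set" where
  "families n m y = {x. x 0 = y \<and> (\<forall>t<m. path_step n (m - Suc t) (x t) (x (Suc t))) \<and>
     (\<forall>i<n. x m i = 0) \<and> (\<forall>t>m. x t = (\<lambda>_. 0))}"

lemma finite_path_step: "finite {y'. path_step n m y y'}"
proof (rule finite_subset)
  show "{y'. path_step n m y y'} \<subseteq> {f. \<forall>i. (i \<in> {..<n} \<longrightarrow> f i \<in> {..Suc (\<Sum>i<n. y i)}) \<and> (i \<notin> {..<n} \<longrightarrow> f i = 0)}"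
  proof clarify
    fix y' i assume h: "path_step n m y y'"
    have "y' i \<le> Suc (y i)" if "i < n" using h that unfolding path_step_def by (auto split: if_splits)
    moreover have "y i \<le> (\<Sum>i<n. y i)" if "i < n" using that by (intro member_le_sum) auto
    ultimately show "(i \<in> {..<n} \<longrightarrow> y' i \<in> {..Suc (\<Sum>i<n. y i)}) \<and> (i \<notin> {..<n} \<longrightarrow> y' i = 0)"
      using h by (force simp: path_step_def)
  qed
qed (rule finite_set_of_finite_funs; simp)

lemma families_0: "families n 0 y = (if \<forall>i<n. y i = 0 then {case_nat y (\<lambda>_ _. 0)} else {})"
proof -
  have "x = case_nat y (\<lambda>_ _. 0)" if "x \<in> families n 0 y" for x
    using that by (intro ext) (auto simp: families_def split: nat.split)
  then show ?thesis by (auto simp: families_def gr0_conv_Suc)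
qed

lemma families_Suc:
  "bij_betw (\<lambda>(y', x). case_nat y x) (SIGMA y' : {y'. path_step n m y y'}. families n m y') (families n (Suc m) y)"
proof (rule bij_betw_byWitness[where f' = "\<lambda>x. (x 1, \<lambda>t. x (Suc t))"])
  show "\<forall>a\<in>SIGMA y' : {y'. path_step n m y y'}. families n m y'. (\<lambda>x. (x 1, \<lambda>t. x (Suc t))) (case a of (y', x) \<Rightarrow> case_nat y x) = a"
    by (auto simp: families_def)
  show "\<forall>x\<in>families n (Suc m) y. (case (x 1, \<lambda>t. x (Suc t)) of (y', x) \<Rightarrow> case_nat y x) = x"
    by (auto simp: families_def fun_eq_iff split: nat.splits)
  show "(\<lambda>(y', x). case_nat y x) ` (SIGMA y' : {y'. path_step n m y y'}. families n m y') \<subseteq> families n (Suc m) y"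
  proof (rule image_subsetI)
    fix p assume "p \<in> (SIGMA y' : {y'. path_step n m y y'}. families n m y')"
    then obtain y' x where p: "p = (y', x)" "path_step n m y y'" "x \<in> families n m y'" by auto
    then show "(case p of (y', x) \<Rightarrow> case_nat y x) \<in> families n (Suc m) y"
      by (auto simp: families_def split: nat.splits)
  qed
  show "(\<lambda>x. (x 1, \<lambda>t. x (Suc t))) ` families n (Suc m) y \<subseteq> (SIGMA y' : {y'. path_step n m y y'}. families n m y')"
  proof (rule image_subsetI)
    fix x assume x: "x \<in> families n (Suc m) y"
    then have st: "path_step n (Suc m - Suc t) (x t) (x (Suc t))" if "t < Suc m" for t
      using that unfolding families_def by blast
    have "path_step n m y (x 1)" using st[of 0] x by (simp add: families_def)
    moreover have "(\<lambda>t. x (Suc t)) \<in> families n m (x 1)"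
      using x st[of "Suc t" for t] by (auto simp: families_def)
    ultimately show "(x 1, \<lambda>t. x (Suc t)) \<in> (SIGMA y' : {y'. path_step n m y y'}. families n m y')" by simp
  qed
qed

lemma finite_families: "finite (families n m y)"
proof (induction m arbitrary: y)
  case 0
  show ?case by (simp add: families_0)
next
  case (Suc m)
  then show ?case
    using bij_betw_finite[OF families_Suc[of y n m]] by (simp add: finite_path_step)
qed

lemma family_sum_eq_sum_families:
  "family_sum n m y = (\<Sum>x\<in>families n m y. \<Prod>t<m. \<Prod>i<n. (- 1) ^ Suc (i + x (Suc t) i))"
proof (induction m arbitrary: y)
  case 0
  show ?case by (simp add: families_0)
next
  case (Suc m)
  have *: "(\<Prod>t<Suc m. \<Prod>i<n. (- 1) ^ Suc (i + case_nat y x (Suc t) i)) =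
    (\<Prod>i<n. (- 1) ^ Suc (i + y' i)) * (\<Prod>t<m. \<Prod>i<n. (- 1) ^ Suc (i + x (Suc t) i) :: rat)"
    if "x \<in> families n m y'" for x y'
    using that by (subst prod.lessThan_Suc_shift) (simp add: families_def)
  have "(\<Sum>x\<in>families n (Suc m) y. \<Prod>t<Suc m. \<Prod>i<n. (- 1) ^ Suc (i + x (Suc t) i) :: rat) =
    (\<Sum>(y', x)\<in>(SIGMA y' : {y'. path_step n m y y'}. families n m y'). \<Prod>t<Suc m. \<Prod>i<n. (- 1) ^ Suc (i + case_nat y x (Suc t) i))"
    by (subst sum.reindex_bij_betw[OF families_Suc, symmetric]) (simp add: case_prod_unfold)
  also have "\<dots> = (\<Sum>y' | path_step n m y y'. \<Sum>x\<in>families n m y'. \<Prod>t<Suc m. \<Prod>i<n. (- 1) ^ Suc (i + case_nat y x (Suc t) i))"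
    by (subst sum.Sigma) (simp_all add: finite_path_step finite_families)
  also have "\<dots> = (\<Sum>y' | path_step n m y y'. (\<Prod>i<n. (- 1) ^ Suc (i + y' i)) * family_sum n m y')"
    unfolding Suc sum_distrib_left by (intro sum.cong refl) (rule *)
  finally show ?case by simp
qed

text \<open>Because of truncated subtraction, the pairs \<open>(c + (n - t), c + (t - n))\<close> run through the
  diagonal \<open>a + t = b + n\<close>, and \<open>c\<close> is the minimum of the two entries.\<close>

definition diagonal :: "nat \<Rightarrow> (nat \<times> nat \<times> nat) set \<Rightarrow> nat \<Rightarrow> nat \<Rightarrow> nat set" where
  "diagonal n R t i = {c. (c + (n - t), c + (t - n), Suc i) \<in> R}"

text \<open>The displacement of path \<open>i\<close> at time \<open>t\<close>. The path follows the
  boundary of level \<open>Suc i\<close>, since consecutive diagonals of a Young diagram differ in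
  length by at most one.\<close>

definition profile :: "nat \<Rightarrow> (nat \<times> nat \<times> nat) set \<Rightarrow> nat \<Rightarrow> nat \<Rightarrow> nat" where
  "profile n R t i = card (diagonal n R t i)"

text \<open>For \<open>a > b + n\<close> the time truncates to 0, where every family considered is
  zero.\<close>

definition unprofile :: "nat \<Rightarrow> (nat \<Rightarrow> nat \<Rightarrow> nat) \<Rightarrow> (nat \<times> nat \<times> nat) set" where
  "unprofile n x = {(a, b, s). 1 \<le> s \<and> min a b < x (b + n - a) (s - 1)}"

lemma downward_closed_eq_lessThan:
  fixes S :: "nat set"
  assumes "finite S" "\<And>c c'. c \<in> S \<Longrightarrow> c' \<le> c \<Longrightarrow> c' \<in> S"
  shows "S = {..<card S}"
proof -
  have "{..c} \<subseteq> S" if "c \<in> S" for c using assms(2)[OF that] by auto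
  then have "card {..c} \<le> card S" if "c \<in> S" for c using assms(1) that by (intro card_mono) auto
  then have "S \<subseteq> {..<card S}" by (auto simp: Suc_le_eq)
  then show ?thesis by (intro card_subset_eq) auto
qed

lemma diagonal_eq:
  assumes R: "stack n R"
  shows "diagonal n R t i = {..<profile n R t i}"
  unfolding profile_def
proof (rule downward_closed_eq_lessThan)
  show "finite (diagonal n R t i)"
    by (rule finite_subset[of _ "{..i}"]) (auto simp: diagonal_def dest: stackD(1-3)[OF R])
  fix c c' assume "c \<in> diagonal n R t i" "c' \<le> c"
  then show "c' \<in> diagonal n R t i"
    unfolding diagonal_def mem_Collect_eq by (rule_tac stackD(4)[OF R]) (auto dest: stackD(1-3)[OF R])
qed

lemma profile_less_iff:
  "stack n R \<Longrightarrow> c < profile n R t i \<longleftrightarrow> (c + (n - t), c + (t - n), Suc i) \<in> R"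
  using diagonal_eq[of n R t i] by (auto simp: diagonal_def)

text \<open>Diagonals lengthen up to the main one at \<open>t = n\<close> and shorten after it. The
  box conditions \<open>a < s\<close> and \<open>b < s\<close> yield the height bounds of the two
  halves.\<close>

lemma profile_path_step:
  assumes R: "stack n R" and "t < 2 * n"
  shows "path_step n (2 * n - Suc t) (profile n R t) (profile n R (Suc t))"
proof -
  let ?x = "profile n R"
  note less = profile_less_iff[OF R] and st = stackD[OF R]
  have zero: "?x t i = 0" if "i \<ge> n" for t i
  proof -
    have False if "0 < ?x t i"
    proof -
      have "(0 + (n - t), 0 + (t - n), Suc i) \<in> R" using that by (simp only: less)
      then show False using st(3) \<open>i \<ge> n\<close> by fastforce
    qed
    then show ?thesis by blast
  qed
  have mono: "?x t i \<le> ?x t (Suc i)" if "Suc i < n" for t i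
  proof (rule ccontr)
    assume "\<not> ?thesis"
    then have "?x t (Suc i) < ?x t i" by simp
    then have "(?x t (Suc i) + (n - t), ?x t (Suc i) + (t - n), Suc i) \<in> R" by (simp only: less)
    then have "(?x t (Suc i) + (n - t), ?x t (Suc i) + (t - n), Suc (Suc i)) \<in> R"
      by (rule st(4)) (use that in auto)
    then show False by (simp only: less[symmetric])
  qed
  have step: "?x (Suc t) i = ?x t i \<or> (if n \<le> 2 * n - Suc t
      then ?x (Suc t) i = Suc (?x t i) \<and> Suc (2 * n - Suc t) - n \<le> Suc (i + ?x t i)
      else ?x t i = Suc (?x (Suc t) i) \<and> Suc n - (2 * n - Suc t) \<le> Suc (i + ?x t i))" for i
  proof (cases "t < n")
    case True
    have 1: "?x t i \<le> ?x (Suc t) i"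
    proof (rule ccontr)
      define c where "c = ?x (Suc t) i"
      assume "\<not> ?thesis"
      then have "c < ?x t i" by (simp add: c_def)
      then have "(c + (n - t), c + (t - n), Suc i) \<in> R" by (simp only: less)
      then have "(c + (n - Suc t), c + (Suc t - n), Suc i) \<in> R"
        by (rule st(4)) (use True \<open>_ \<in> R\<close> st(3) in auto)
      then show False by (simp only: less[symmetric] c_def)
    qed
    have 2: "?x (Suc t) i \<le> Suc (?x t i)"
    proof (rule ccontr)
      define c where "c = ?x t i"
      assume "\<not> ?thesis"
      then have "Suc c < ?x (Suc t) i" by (simp add: c_def)
      then have "(Suc c + (n - Suc t), Suc c + (Suc t - n), Suc i) \<in> R" by (simp only: less)
      then have "(c + (n - t), c + (t - n), Suc i) \<in> R"
        by (rule st(4)) (use True \<open>_ \<in> R\<close> st(3) in auto)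
      then show False by (simp only: less[symmetric] c_def)
    qed
    have 3: "n - t \<le> Suc (i + ?x t i)" if "?x (Suc t) i = Suc (?x t i)"
    proof -
      have "?x t i < ?x (Suc t) i" using that by simp
      then have "(?x t i + (n - Suc t), ?x t i + (Suc t - n), Suc i) \<in> R" by (simp only: less)
      then show ?thesis using st(1) by fastforce
    qed
    have "n \<le> 2 * n - Suc t" "Suc (2 * n - Suc t) - n = n - t" using True by auto
    then show ?thesis using 1 2 3 by auto
  next
    case False
    have 1: "?x (Suc t) i \<le> ?x t i"
    proof (rule ccontr)
      define c where "c = ?x t i"
      assume "\<not> ?thesis"
      then have "c < ?x (Suc t) i" by (simp add: c_def)
      then have "(c + (n - Suc t), c + (Suc t - n), Suc i) \<in> R" by (simp only: less)
      then have "(c + (n - t), c + (t - n), Suc i) \<in> R"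
        by (rule st(4)) (use False \<open>_ \<in> R\<close> st(3) in auto)
      then show False by (simp only: less[symmetric] c_def)
    qed
    have 2: "?x t i \<le> Suc (?x (Suc t) i)"
    proof (rule ccontr)
      define c where "c = ?x (Suc t) i"
      assume "\<not> ?thesis"
      then have "Suc c < ?x t i" by (simp add: c_def)
      then have "(Suc c + (n - t), Suc c + (t - n), Suc i) \<in> R" by (simp only: less)
      then have "(c + (n - Suc t), c + (Suc t - n), Suc i) \<in> R"
        by (rule st(4)) (use False \<open>_ \<in> R\<close> st(3) in auto)
      then show False by (simp only: less[symmetric] c_def)
    qed
    have 3: "Suc (Suc t) - n \<le> Suc (i + ?x t i)" if "?x t i = Suc (?x (Suc t) i)"
    proof -
      have "?x (Suc t) i < ?x t i" using that by simp
      then have "(?x (Suc t) i + (n - t), ?x (Suc t) i + (t - n), Suc i) \<in> R" by (simp only: less)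
      then have "?x (Suc t) i + (t - n) < Suc i" by (rule st(2))
      then show ?thesis using that by simp
    qed
    have "\<not> n \<le> 2 * n - Suc t" "Suc n - (2 * n - Suc t) = Suc (Suc t) - n" using False assms(2) by auto
    then show ?thesis using 1 2 3 by auto
  qed
  show ?thesis
    unfolding path_step_def using zero mono step by blast
qed

lemma profile_in_families:
  assumes R: "stack n R"
  shows "profile n R \<in> families n (2 * n) (\<lambda>_. 0)"
proof -
  note less = profile_less_iff[OF R] and st = stackD[OF R]
  have "profile n R 0 i = 0" for i
  proof -
    have False if "0 < profile n R 0 i"
    proof -
      have "(0 + (n - 0), 0 + (0 - n), Suc i) \<in> R" using that by (simp only: less)
      from st(1)[OF this] st(3)[OF this] show False by simp
    qed
    then show ?thesis by blast
  qed
  moreover have "profile n R t i = 0" if "t \<ge> 2 * n" for t i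
  proof -
    have False if "0 < profile n R t i"
    proof -
      have "(0 + (n - t), 0 + (t - n), Suc i) \<in> R" using that by (simp only: less)
      from st(2)[OF this] st(3)[OF this] show False using \<open>t \<ge> 2 * n\<close> by simp
    qed
    then show ?thesis by blast
  qed
  ultimately show ?thesis
    using profile_path_step[OF R] by (auto simp: families_def fun_eq_iff)
qed

lemma unprofile_profile:
  assumes R: "stack n R"
  shows "unprofile n (profile n R) = R"
proof -
  note st = stackD[OF R]
  have "(a, b, s) \<in> unprofile n (profile n R) \<longleftrightarrow> (a, b, s) \<in> R" for a b s
  proof (cases "1 \<le> s \<and> a \<le> b + n")
    case True
    then have "min a b + (n - (b + n - a)) = a" "min a b + (b + n - a - n) = b" "Suc (s - 1) = s" by auto
    then show ?thesis using True by (simp add: unprofile_def profile_less_iff[OF R])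
  next
    case False
    have "profile n R 0 (s - 1) = 0" using profile_in_families[OF R] by (simp add: families_def)
    then have "(a, b, s) \<notin> unprofile n (profile n R)" using False by (auto simp: unprofile_def)
    moreover have "(a, b, s) \<notin> R" using False st(1,3)[of a b s] by auto
    ultimately show ?thesis by blast
  qed
  then show ?thesis by auto
qed

section \<open>From path families back to chains of partitions\<close>

context
  fixes n :: nat and x :: "nat \<Rightarrow> nat \<Rightarrow> nat"
  assumes x: "x \<in> families n (2 * n) (\<lambda>_. 0)"
begin

lemma families_step: "t < 2 * n \<Longrightarrow> path_step n (2 * n - Suc t) (x t) (x (Suc t))"
  using x by (simp add: families_def)

lemma families_start: "x 0 i = 0"
  using x by (simp add: families_def)

lemma families_outside: "n \<le> i \<Longrightarrow> x t i = 0"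
proof (cases t)
  case (Suc t')
  assume "n \<le> i"
  then show ?thesis using families_step[of t'] x Suc
    by (cases "t' < 2 * n") (auto simp: path_step_def families_def)
qed (simp add: families_start)

lemma families_end: "2 * n \<le> t \<Longrightarrow> x t i = 0"
  using x families_outside[of i t] by (cases "t = 2 * n"; cases "i < n") (auto simp: families_def)

lemma families_mono: "Suc i < n \<Longrightarrow> x t i \<le> x t (Suc i)"
proof (cases t)
  case (Suc t')
  assume "Suc i < n"
  then show ?thesis using families_step[of t'] families_end[of t i] Suc
    by (cases "t' < 2 * n") (auto simp: path_step_def)
qed (simp add: families_start)

lemma families_up:
  assumes "t < n"
  shows "x (Suc t) i = x t i \<or> x (Suc t) i = Suc (x t i) \<and> n - t \<le> Suc (i + x t i)"
proof (cases "i < n")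
  case True
  have "n \<le> 2 * n - Suc t" "Suc (2 * n - Suc t) - n = n - t" "t < 2 * n" using assms by auto
  then show ?thesis using families_step[of t] True by (auto simp: path_step_def)
qed (simp add: families_outside)

lemma families_down:
  assumes "n \<le> t"
  shows "x t i = x (Suc t) i \<or> x t i = Suc (x (Suc t) i) \<and> t - n < i + x t i"
proof (cases "i < n \<and> t < 2 * n")
  case True
  then have "\<not> n \<le> 2 * n - Suc t" "Suc n - (2 * n - Suc t) = Suc (Suc t) - n" using assms by auto
  moreover have "Suc (Suc t) - n = Suc (Suc (t - n))" using assms by auto
  ultimately show ?thesis using families_step[of t] True by (auto simp: path_step_def)
qed (use families_outside families_end in auto)

text \<open>The height bound acts at the first ascent; afterwards \<open>x t i\<close> grows no
  faster than \<open>t\<close>. The second half is the same read backwards from the end. These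
  bounds put \<open>unprofile\<close> inside its boxes.\<close>

lemma families_bound_up: "t \<le> n \<Longrightarrow> x t i + n \<le> t + Suc i \<or> x t i = 0"
proof (induction t)
  case (Suc t)
  then show ?case using families_up[of t i] by auto
qed (simp add: families_start)

lemma families_bound_down:
  assumes "t \<le> 2 * n" "n \<le> t"
  shows "x t i + t \<le> n + Suc i \<or> x t i = 0"
  using assms
proof (induction rule: inc_induct)
  case base
  show ?case by (simp add: families_end)
next
  case (step t)
  then show ?case using families_down[of t i] by auto
qed

lemma unprofile_bound:
  assumes "(a, b, s) \<in> unprofile n x"
  shows "a < s \<and> b < s \<and> s \<le> n"
proof -
  define t where "t = b + n - a"
  have s: "1 \<le> s" "min a b < x t (s - 1)" using assms by (auto simp: unprofile_def t_def)
  have t: "t \<noteq> 0" "t < 2 * n" "s - 1 < n"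
    using s families_start families_end families_outside by (metis not_less_zero, metis not_less not_less_zero, metis not_less not_less_zero)
  show ?thesis
  proof (cases "t \<le> n")
    case True
    then show ?thesis using families_bound_up[of t "s - 1"] s t by (auto simp: t_def)
  next
    case False
    then show ?thesis using families_bound_down[of t "s - 1"] s t by (auto simp: t_def)
  qed
qed

text \<open>Lowering \<open>a\<close> passes to the next diagonal. In the first half the minimum
  stays \<open>b\<close> and the profile does not drop; in the second the minimum drops by one and
  the profile by at most one.\<close>

lemma unprofile_decrease_left:
  assumes "(Suc a, b, s) \<in> unprofile n x"
  shows "(a, b, s) \<in> unprofile n x"
proof -
  define t where "t = b + n - Suc a"
  have s: "1 \<le> s" "min (Suc a) b < x t (s - 1)" using assms by (auto simp: unprofile_def t_def)
  have "Suc a < n" using unprofile_bound[OF assms] by simp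
  then have t: "b + n - a = Suc t" by (simp add: t_def)
  have "min a b < x (Suc t) (s - 1)"
  proof (cases "t < n")
    case True
    then have "b \<le> a" by (simp add: t_def)
    then show ?thesis using families_up[OF True, of "s - 1"] s by auto
  next
    case False
    then have "a < b" using t by simp
    then show ?thesis using families_down[of t "s - 1"] False s by auto
  qed
  then show ?thesis using s t by (simp add: unprofile_def)
qed

lemma unprofile_decrease_right:
  assumes "(a, Suc b, s) \<in> unprofile n x"
  shows "(a, b, s) \<in> unprofile n x"
proof -
  define t where "t = b + n - a"
  have "a < n" using unprofile_bound[OF assms] by simp
  then have t: "Suc b + n - a = Suc t" by (simp add: t_def)
  then have s: "1 \<le> s" "min a (Suc b) < x (Suc t) (s - 1)" using assms by (auto simp: unprofile_def)
  have "min a b < x t (s - 1)"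
  proof (cases "t < n")
    case True
    then have "b < a" by (simp add: t_def)
    then show ?thesis using families_up[OF True, of "s - 1"] s by auto
  next
    case False
    then have "a \<le> b" using t by simp
    then show ?thesis using families_down[of t "s - 1"] False s by auto
  qed
  then show ?thesis using s by (simp add: unprofile_def t_def)
qed

lemma unprofile_increase:
  assumes "(a, b, s) \<in> unprofile n x" "s < n"
  shows "(a, b, Suc s) \<in> unprofile n x"
  using assms families_mono[of "s - 1" "b + n - a"] by (auto simp: unprofile_def)

lemma stack_unprofile: "stack n (unprofile n x)"
  unfolding stack_def
proof (intro conjI allI impI)
  fix a b s a' b' s'
  assume h: "(a, b, s) \<in> unprofile n x \<and> a' \<le> a \<and> b' \<le> b \<and> s \<le> s' \<and> s' \<le> n"
  then have "a' \<le> a" "b' \<le> b" "s \<le> s'" by auto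
  from \<open>a' \<le> a\<close> have "(a', b, s) \<in> unprofile n x"
    by (induction rule: inc_induct) (use h in \<open>auto intro: unprofile_decrease_left\<close>)
  with \<open>b' \<le> b\<close> have "(a', b', s) \<in> unprofile n x"
    by (induction rule: inc_induct) (auto intro: unprofile_decrease_right)
  with \<open>s \<le> s'\<close> show "(a', b', s') \<in> unprofile n x"
    by (induction rule: dec_induct) (use h in \<open>auto intro: unprofile_increase\<close>)
qed (auto dest: unprofile_bound)

lemma profile_unprofile: "profile n (unprofile n x) = x"
proof (intro ext)
  fix t i
  show "profile n (unprofile n x) t i = x t i"
  proof (cases "t \<le> 2 * n")
    case True
    then have e: "min (c + (n - t)) (c + (t - n)) = c" "c + (t - n) + n - (c + (n - t)) = t" for c by auto
    have "diagonal n (unprofile n x) t i = {..<x t i}"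
      unfolding diagonal_def unprofile_def mem_Collect_eq case_prod_conv e by auto
    then show ?thesis by (simp add: profile_def)
  next
    case False
    then show ?thesis
      using profile_in_families[OF stack_unprofile] families_end[of t i] by (simp add: families_def)
  qed
qed

end

text \<open>The diagonals partition \<open>R\<close>. Time 0 may be left out because its diagonal is
  empty, which matches weights read off after each step.\<close>

lemma card_stack:
  assumes R: "stack n R"
  shows "card R = (\<Sum>t<2 * n. \<Sum>i<n. profile n R (Suc t) i)"
proof -
  note st = stackD[OF R]
  let ?D = "\<lambda>t i. diagonal n R (Suc t) i"
  have fin: "finite (?D t i)" for t i by (simp add: diagonal_eq[OF R])
  have "bij_betw (\<lambda>(t, i, c). (c + (n - Suc t), c + (Suc t - n), Suc i)) (SIGMA t:{..<2 * n}. SIGMA i:{..<n}. ?D t i) R"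
  proof (rule bij_betw_byWitness[where f' = "\<lambda>(a, b, s). (b + n - a - 1, s - 1, min a b)"])
    show "\<forall>z\<in>SIGMA t:{..<2 * n}. SIGMA i:{..<n}. ?D t i.
       (\<lambda>(a, b, s). (b + n - a - 1, s - 1, min a b)) ((\<lambda>(t, i, c). (c + (n - Suc t), c + (Suc t - n), Suc i)) z) = z"
      by auto
    show "\<forall>z\<in>R. (\<lambda>(t, i, c). (c + (n - Suc t), c + (Suc t - n), Suc i)) ((\<lambda>(a, b, s). (b + n - a - 1, s - 1, min a b)) z) = z"
    proof
      fix z assume "z \<in> R"
      moreover obtain a b s where z: "z = (a, b, s)" by (cases z)
      ultimately show "(\<lambda>(t, i, c). (c + (n - Suc t), c + (Suc t - n), Suc i)) ((\<lambda>(a, b, s). (b + n - a - 1, s - 1, min a b)) z) = z"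
        using st(1-3)[of a b s] by auto
    qed
    show "(\<lambda>(t, i, c). (c + (n - Suc t), c + (Suc t - n), Suc i)) ` (SIGMA t:{..<2 * n}. SIGMA i:{..<n}. ?D t i) \<subseteq> R"
      by (auto simp: diagonal_def)
    show "(\<lambda>(a, b, s). (b + n - a - 1, s - 1, min a b)) ` R \<subseteq> (SIGMA t:{..<2 * n}. SIGMA i:{..<n}. ?D t i)"
    proof (rule image_subsetI)
      fix z assume "z \<in> R"
      then obtain a b s where z: "z = (a, b, s)" and r: "(a, b, s) \<in> R" by (cases z) auto
      have l: "a < s" "b < s" "s \<le> n" using st(1-3)[OF r] by auto
      then have "min a b + (n - Suc (b + n - a - 1)) = a" "min a b + (Suc (b + n - a - 1) - n) = b" "Suc (s - 1) = s"
        by auto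
      then have "min a b \<in> ?D (b + n - a - 1) (s - 1)" using r by (simp only: diagonal_def mem_Collect_eq)
      then show "(\<lambda>(a, b, s). (b + n - a - 1, s - 1, min a b)) z \<in> (SIGMA t:{..<2 * n}. SIGMA i:{..<n}. ?D t i)"
        using l by (auto simp: z)
    qed
  qed
  from bij_betw_same_card[OF this] have "card R = card (SIGMA t:{..<2 * n}. SIGMA i:{..<n}. ?D t i)" ..
  also have "\<dots> = (\<Sum>t<2 * n. \<Sum>i<n. profile n R (Suc t) i)"
    using fin by (simp add: profile_def)
  finally show ?thesis .
qed

lemma sum_stack_eq_family_sum:
  "(\<Sum>R | stack n R. (- 1) ^ card R) = family_sum n (2 * n) (\<lambda>_. 0)"
proof -
  have "(\<Sum>R | stack n R. (- 1) ^ card R) =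
    (\<Sum>x\<in>families n (2 * n) (\<lambda>_. 0). \<Prod>t<2 * n. \<Prod>i<n. (- 1) ^ Suc (i + x (Suc t) i) :: rat)"
  proof (rule sum.reindex_bij_witness[of _ "unprofile n" "profile n"])
    fix R assume "R \<in> {R. stack n R}"
    then have R: "stack n R" by simp
    have "(\<Prod>t<2 * n. \<Prod>i<n. (- 1) ^ Suc (i + profile n R (Suc t) i) :: rat) =
      (- 1) ^ (\<Sum>t<2 * n. \<Sum>i<n. Suc i + profile n R (Suc t) i)"
      by (simp add: power_sum)
    also have "(\<Sum>t<2 * n. \<Sum>i<n. Suc i + profile n R (Suc t) i) = 2 * n * (\<Sum>i<n. Suc i) + card R"
      by (simp only: card_stack[OF R] sum.distrib sum_constant card_lessThan of_nat_id)
    also have "(- 1) ^ (2 * n * (\<Sum>i<n. Suc i) + card R) = ((- 1) ^ card R :: rat)"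
      by (simp add: power_add)
    finally show "(\<Prod>t<2 * n. \<Prod>i<n. (- 1) ^ Suc (i + profile n R (Suc t) i)) = ((- 1) ^ card R :: rat)" .
  qed (auto simp: unprofile_profile profile_unprofile stack_unprofile profile_in_families)
  then show ?thesis by (simp only: family_sum_eq_sum_families)
qed

theorem theorem4:
  fixes \<alpha> :: nat
  assumes "\<alpha> \<ge> 1"
  shows "(\<Sum>P \<in> CSTCPP \<alpha>. (- 1 :: rat) ^ n_orbits \<alpha> P) =
           (if odd \<alpha>
            then (\<Prod>k = 1..(\<alpha> - 1) div 2. fact (6 * k - 2) / fact (2 * k + \<alpha> - 1)) ^ 2
            else 0)"
proof -
  obtain n where \<alpha>: "\<alpha> = Suc n" using assms by (cases \<alpha>) auto
  show ?thesis
    unfolding \<alpha> sum_CSTCPP_eq_sum_stack sum_stack_eq_family_sum family_sum_eval by simp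
qed

end
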